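(* Let $\mathcal A=((A,[\,,\,]_A),(V,\rho),T)$ and $\mathcal B=((B,[\,,\,]_B),(M,\nu_M),S)$ be two relative Rota-Baxter Lie algebras over a field $k$, and let $\mathcal E:0\to\mathcal B\xrightarrow{(\mathfrak i,i)}\hat{\mathcal A}\xrightarrow{(\mathfrak p,p)}\mathcal A\to0$ be an abelian extension of $\mathcal A$ by $\mathcal B$. Then there is an exact sequence $$0\longrightarrow\mathcal Z^1(\mathcal A,\mathcal B)\xrightarrow{\iota}\mathrm{Der}_{\mathcal B}(\hat{\mathcal A})\xrightarrow{F}\mathfrak g(\mathcal A,\mathcal B)\xrightarrow{W}\mathcal H^2(\mathcal A,\mathcal B).$$
   Context: A relative Rota-Baxter Lie algebra is a triple $((A,[\,,\,]_A),(V,\rho),T)$ where $(A,[\,,\,]_A)$ is a Lie algebra, $\rho:A\to\mathfrak{gl}(V)$ is a representation of $A$ on the vector space $V$, and $T:V\to A$ is a linear map with $[T(u),T(v)]_A=T(\rho(T(u))v-\rho(T(v))u)$ for all $u,v\in V$. It is abelian if $[\,,\,]_A=0$ and $\rho=0$. A homomorphism from $((A,[\,,\,]_A),(V,\rho),T)$ to $((A',[\,,\,]_{A'}),(V',\rho'),T')$ is a pair $(\varphi,\phi)$ with $\varphi:A\to A'$ a Lie algebra homomorphism and $\phi:V\to V'$ linear such that $T'\phi=\varphi T$ and $\phi(\rho(x)v)=\rho'(\varphi(x))\phi(v)$. A derivation of $\mathcal A$ is a pair $d_{\mathcal A}=(d_A,d_V)$ of linear maps $d_A:A\to A$, $d_V:V\to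 V$ such that $d_A$ is a derivation of the Lie algebra $A$, $Td_V=d_AT$, and $d_V(\rho(x)v)=\rho(x)d_V(v)+\rho(d_A(x))v$; $\mathrm{Der}(\mathcal A)$ is the Lie algebra of derivations. $\mathrm{End}(\mathcal B)$ is the set of pairs $d_{\mathcal B}=(d_B,d_M)$ of linear maps $d_B:B\to B$, $d_M:M\to M$. An abelian extension of $\mathcal A$ by $\mathcal B$, where $\mathcal B$ is abelian, is a relative Rota-Baxter Lie algebra $\hat{\mathcal A}=((\hat A,[\,,\,]_{\hat A}),(\hat V,\hat\rho),\hat T)$ with homomorphisms $(\mathfrak i,i):\mathcal B\to\hat{\mathcal A}$ and $(\mathfrak p,p):\hat{\mathcal A}\to\mathcal A$ such that $0\to B\xrightarrow{\mathfrak i}\hat A\xrightarrow{\mathfrak p}A\to0$ and $0\to M\xrightarrow{i}\hat V\xrightarrow{p}V\to0$ are exact. $B$ and $M$ are identified with their images. Fix a section, i.e. linear maps $\mathfrak s:A\to\hat A$, $s:V\to\hat V$ with $\mathfrak p\mathfrak s=\mathrm{id}_A$, $ps=\mathrm{id}_V$. The induced maps are $\omega(x,y)=[\mathfrak s(x),\mathfrak s(y)]_{\hat A}-\mathfrak s([x,y]_A)\in B$, $\varpi(x,v)=\hat\rho(\mathfrak s(x))s(v)-s(\rho(x)v)\in M$, $\chi(v)=\hat T(s(v))-\mathfrak s(T(v))\in B$, $\mu(v)a=-\hat\rho(a)s(v)\in M$, $\rho_B(x)a=[\mathfrak s(x),a]_{\hat A}\in B$, $\rho_M(x)m=\hat\rho(\mathfrak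 s(x))m\in M$. $\mathrm{Der}_{\mathcal B}(\hat{\mathcal A})$ is the set of derivations $(d_{\hat A},d_{\hat V})$ of $\hat{\mathcal A}$ with $d_{\hat A}(B)\subseteq B$, $d_{\hat V}(M)\subseteq M$, and $F(d_{\hat A},d_{\hat V})=((\mathfrak pd_{\hat A}\mathfrak s,pd_{\hat V}s),(d_{\hat A}|_B,d_{\hat V}|_M))$. $\mathfrak g(\mathcal A,\mathcal B)$ is the Lie algebra (componentwise commutator) of $(d_{\mathcal A},d_{\mathcal B})\in\mathrm{Der}(\mathcal A)\times\mathrm{End}(\mathcal B)$ such that for all $x\in A$, $a\in B$, $m\in M$, $v\in V$: $d_M(\rho_M(x)m)=\rho_M(x)d_M(m)+\rho_M(d_Ax)m$, $d_B(\rho_B(x)a)=\rho_B(x)d_B(a)+\rho_B(d_Ax)a$, $d_M(\mu(v)a)=\mu(d_Vv)a+\mu(v)d_B(a)$, $d_BS=Sd_M$. Cohomology (coefficients in $(M\xrightarrow{S}B,\rho_B,\rho_M,\mu)$): $\mathcal Z^1(\mathcal A,\mathcal B)$ is the space of pairs of linear maps $\varphi_B:A\to B$, $\varphi_M:V\to M$ with $\rho_B(x)\varphi_B(y)-\rho_B(y)\varphi_B(x)=\varphi_B([x,y]_A)$, $\mu(v)\varphi_B(x)+\varphi_M(\rho(x)v)=\rho_M(x)\varphi_M(v)$, $\varphi_B(Tv)=S\varphi_M(v)$. The map $\iota$ sends $(f_B,f_M)\in\mathcal Z^1(\mathcal A,\mathcal B)$ to $(d_{\hat A},d_{\hat V})$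 with $d_{\hat A}(\mathfrak s(x)+a)=f_B(x)$, $d_{\hat V}(s(v)+m)=f_M(v)$. $\mathcal Z^2(\mathcal A,\mathcal B)$ is the space of $(f_B,f_M,\theta)\in\mathrm{Hom}(\wedge^2A,B)\oplus\mathrm{Hom}(A\otimes V,M)\oplus\mathrm{Hom}(V,B)$ such that for all $x,y,z\in A$, $v,v_1,v_2\in V$: $\rho_B(x)f_B(y,z)-\rho_B(y)f_B(x,z)+\rho_B(z)f_B(x,y)-f_B([x,y]_A,z)+f_B([x,z]_A,y)-f_B([y,z]_A,x)=0$; $-f_M([x,y]_A,v)+\mu(v)f_B(x,y)+\rho_M(x)f_M(y,v)-\rho_M(y)f_M(x,v)-f_M(y,\rho(x)v)+f_M(x,\rho(y)v)=0$; $\rho_B(Tv_1)\theta(v_2)-\rho_B(Tv_2)\theta(v_1)-S(\mu(v_1)\theta(v_2)-\mu(v_2)\theta(v_1))-\theta(\rho(Tv_1)v_2-\rho(Tv_2)v_1)+f_B(Tv_1,Tv_2)-S(f_M(Tv_1,v_2)-f_M(Tv_2,v_1))=0$. $\mathcal B^2(\mathcal A,\mathcal B)$ is the set of $((\delta\varphi)_B,(\delta\varphi)_M,h_T\varphi)$ with $\varphi_B:A\to B$, $\varphi_M:V\to M$ linear, $(\delta\varphi)_B(x,y)=\rho_B(x)\varphi_B(y)-\rho_B(y)\varphi_B(x)-\varphi_B([x,y]_A)$, $(\delta\varphi)_M(x,v)=-\mu(v)\varphi_B(x)+\rho_M(x)\varphi_M(v)-\varphi_M(\rho(x)v)$, $(h_T\varphi)(v)=-\varphi_B(Tv)+S\varphi_M(v)$.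 $\mathcal H^2=\mathcal Z^2/\mathcal B^2$. The Wells map $W:\mathfrak g(\mathcal A,\mathcal B)\to\mathcal H^2(\mathcal A,\mathcal B)$ sends $(d_{\mathcal A},d_{\mathcal B})$ to the class of $(d_B\omega-\omega(d_A\otimes\mathrm{id}_A)-\omega(\mathrm{id}_A\otimes d_A),\ d_M\varpi-\varpi(d_A\otimes\mathrm{id}_V)-\varpi(\mathrm{id}_A\otimes d_V),\ d_B\chi-\chi d_V)$. *)

theory Defs
  imports Complex_Main "HOL-Library.Function_Algebras" "HOL-Library.Product_Plus"
begin

text \<open>
  Every vector space of the data is a whole type of class \<open>ab_group_add\<close> with an explicit scalar
  multiplication by a field \<open>'k\<close>, as in \<open>HOL.Vector_Spaces\<close>.  The spaces of (pairs of) maps built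
  from them are subsets of function types, with pointwise operations, and the second cohomology
  is a set of cosets; these are handled by the carrier-based vector spaces defined first.
\<close>

section \<open>Carrier-based vector spaces and exactness\<close>

record ('k, 'x) vspace =
  vcarrier :: "'x set"
  vadd :: "'x \<Rightarrow> 'x \<Rightarrow> 'x"
  vzero :: 'x
  vscale :: "'k \<Rightarrow> 'x \<Rightarrow> 'x"

definition is_vspace :: "('k::field, 'x) vspace \<Rightarrow> bool" where
  "is_vspace X \<longleftrightarrow>
     (\<forall>x\<in>vcarrier X. \<forall>y\<in>vcarrier X. vadd X x y \<in> vcarrier X \<and> vadd X x y = vadd X y x) \<and>
     (\<forall>x\<in>vcarrier X. \<forall>y\<in>vcarrier X. \<forall>z\<in>vcarrier X.
        vadd X (vadd X x y) z = vadd X x (vadd X y z)) \<and>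
     vzero X \<in> vcarrier X \<and>
     (\<forall>x\<in>vcarrier X. vadd X (vzero X) x = x \<and> (\<exists>y\<in>vcarrier X. vadd X x y = vzero X)) \<and>
     (\<forall>c. \<forall>x\<in>vcarrier X. vscale X c x \<in> vcarrier X) \<and>
     (\<forall>c. \<forall>x\<in>vcarrier X. \<forall>y\<in>vcarrier X.
        vscale X c (vadd X x y) = vadd X (vscale X c x) (vscale X c y)) \<and>
     (\<forall>c d. \<forall>x\<in>vcarrier X.
        vscale X (c + d) x = vadd X (vscale X c x) (vscale X d x) \<and>
        vscale X (c * d) x = vscale X c (vscale X d x)) \<and>
     (\<forall>x\<in>vcarrier X. vscale X 1 x = x)"

definition vhom :: "('k, 'x) vspace \<Rightarrow> ('k, 'y) vspace \<Rightarrow> ('x \<Rightarrow> 'y) set" where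
  "vhom X Y = {f.
     (\<forall>x\<in>vcarrier X. f x \<in> vcarrier Y) \<and>
     (\<forall>x\<in>vcarrier X. \<forall>y\<in>vcarrier X. f (vadd X x y) = vadd Y (f x) (f y)) \<and>
     (\<forall>c. \<forall>x\<in>vcarrier X. f (vscale X c x) = vscale Y c (f x))}"

definition vkernel :: "('k, 'x) vspace \<Rightarrow> ('k, 'y) vspace \<Rightarrow> ('x \<Rightarrow> 'y) \<Rightarrow> 'x set" where
  "vkernel X Y f = {x \<in> vcarrier X. f x = vzero Y}"

text \<open>Exactness of \<open>0 \<rightarrow> X1 \<rightarrow> X2 \<rightarrow> X3 \<rightarrow> X4\<close> (at \<open>X1\<close>, \<open>X2\<close> and \<open>X3\<close>) as a sequence of
  vector spaces and linear maps.\<close>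

definition exact_0_4 ::
    "('k::field, 'x) vspace \<Rightarrow> ('x \<Rightarrow> 'y) \<Rightarrow> ('k, 'y) vspace \<Rightarrow> ('y \<Rightarrow> 'z) \<Rightarrow>
     ('k, 'z) vspace \<Rightarrow> ('z \<Rightarrow> 'u) \<Rightarrow> ('k, 'u) vspace \<Rightarrow> bool" where
  "exact_0_4 X1 f1 X2 f2 X3 f3 X4 \<longleftrightarrow>
     is_vspace X1 \<and> is_vspace X2 \<and> is_vspace X3 \<and> is_vspace X4 \<and>
     f1 \<in> vhom X1 X2 \<and> f2 \<in> vhom X2 X3 \<and> f3 \<in> vhom X3 X4 \<and>
     vkernel X1 X2 f1 = {vzero X1} \<and>
     f1 ` vcarrier X1 = vkernel X2 X3 f2 \<and>
     f2 ` vcarrier X2 = vkernel X3 X4 f3"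

definition sub_vspace :: "('k \<Rightarrow> 'x \<Rightarrow> 'x) \<Rightarrow> 'x::ab_group_add set \<Rightarrow> ('k, 'x) vspace" where
  "sub_vspace sc S = \<lparr>vcarrier = S, vadd = (+), vzero = 0, vscale = sc\<rparr>"

definition coset :: "'x::ab_group_add set \<Rightarrow> 'x \<Rightarrow> 'x set" where
  "coset N z = {z + n | n. n \<in> N}"

text \<open>The quotient \<open>Z / N\<close>.  In \<open>vscale\<close> the summand \<open>n\<close> only matters for the scalar \<open>0\<close>, where
  the elementwise multiple of a coset would be \<open>{0}\<close> instead of \<open>N\<close>.\<close>

definition quotient_vspace ::
    "('k \<Rightarrow> 'x \<Rightarrow> 'x) \<Rightarrow> 'x::ab_group_add set \<Rightarrow> 'x set \<Rightarrow> ('k, 'x set) vspace" where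
  "quotient_vspace sc Z N =
     \<lparr>vcarrier = coset N ` Z,
      vadd = (\<lambda>X Y. {x + y | x y. x \<in> X \<and> y \<in> Y}),
      vzero = N,
      vscale = (\<lambda>c X. {sc c x + n | x n. x \<in> X \<and> n \<in> N})\<rparr>"

definition fun_scale :: "('k \<Rightarrow> 'y \<Rightarrow> 'y) \<Rightarrow> 'k \<Rightarrow> ('x \<Rightarrow> 'y) \<Rightarrow> ('x \<Rightarrow> 'y)" where
  "fun_scale sc c f = (\<lambda>x. sc c (f x))"

definition prod_scale ::
    "('k \<Rightarrow> 'x \<Rightarrow> 'x) \<Rightarrow> ('k \<Rightarrow> 'y \<Rightarrow> 'y) \<Rightarrow> 'k \<Rightarrow> 'x \<times> 'y \<Rightarrow> 'x \<times> 'y" where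
  "prod_scale sc sc' c z = (sc c (fst z), sc' c (snd z))"

definition bilinear_map ::
    "('k::field \<Rightarrow> 'x::ab_group_add \<Rightarrow> 'x) \<Rightarrow> ('k \<Rightarrow> 'y::ab_group_add \<Rightarrow> 'y) \<Rightarrow>
     ('k \<Rightarrow> 'z::ab_group_add \<Rightarrow> 'z) \<Rightarrow> ('x \<Rightarrow> 'y \<Rightarrow> 'z) \<Rightarrow> bool" where
  "bilinear_map sx sy sz f \<longleftrightarrow>
     (\<forall>x. Vector_Spaces.linear sy sz (f x)) \<and> (\<forall>y. Vector_Spaces.linear sx sz (\<lambda>x. f x y))"

section \<open>Relative Rota-Baxter Lie algebras\<close>

text \<open>The data \<open>((A, [,]), (V, \<rho>), T)\<close>, together with the scalar multiplications of \<open>A\<close> and \<open>V\<close>.\<close>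

record ('k, 'a, 'v) rrb_data =
  lsc :: "'k \<Rightarrow> 'a \<Rightarrow> 'a"
  msc :: "'k \<Rightarrow> 'v \<Rightarrow> 'v"
  brk :: "'a \<Rightarrow> 'a \<Rightarrow> 'a"
  act :: "'a \<Rightarrow> 'v \<Rightarrow> 'v"
  rbo :: "'v \<Rightarrow> 'a"

definition lie_algebra ::
    "('k::field \<Rightarrow> 'a::ab_group_add \<Rightarrow> 'a) \<Rightarrow> ('a \<Rightarrow> 'a \<Rightarrow> 'a) \<Rightarrow> bool" where
  "lie_algebra sc br \<longleftrightarrow>
     vector_space sc \<and> bilinear_map sc sc sc br \<and>
     (\<forall>x. br x x = 0) \<and>
     (\<forall>x y z. br x (br y z) + br y (br z x) + br z (br x y) = 0)"

definition lie_representation ::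
    "('k::field \<Rightarrow> 'a::ab_group_add \<Rightarrow> 'a) \<Rightarrow> ('a \<Rightarrow> 'a \<Rightarrow> 'a) \<Rightarrow>
     ('k \<Rightarrow> 'v::ab_group_add \<Rightarrow> 'v) \<Rightarrow> ('a \<Rightarrow> 'v \<Rightarrow> 'v) \<Rightarrow> bool" where
  "lie_representation sa br sv rho \<longleftrightarrow>
     vector_space sv \<and> bilinear_map sa sv sv rho \<and>
     (\<forall>x y v. rho (br x y) v = rho x (rho y v) - rho y (rho x v))"

definition rel_rota_baxter ::
    "('k::field, 'a::ab_group_add, 'v::ab_group_add) rrb_data \<Rightarrow> bool" where
  "rel_rota_baxter A \<longleftrightarrow>
     lie_algebra (lsc A) (brk A) \<and>
     lie_representation (lsc A) (brk A) (msc A) (act A) \<and>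
     Vector_Spaces.linear (msc A) (lsc A) (rbo A) \<and>
     (\<forall>u v. brk A (rbo A u) (rbo A v) = rbo A (act A (rbo A u) v - act A (rbo A v) u))"

definition rrb_abelian ::
    "('k, 'a::ab_group_add, 'v::ab_group_add) rrb_data \<Rightarrow> bool" where
  "rrb_abelian A \<longleftrightarrow> (\<forall>x y. brk A x y = 0) \<and> (\<forall>x v. act A x v = 0)"

definition rrb_hom ::
    "('k::field, 'a::ab_group_add, 'v::ab_group_add) rrb_data \<Rightarrow>
     ('k, 'b::ab_group_add, 'm::ab_group_add) rrb_data \<Rightarrow> ('a \<Rightarrow> 'b) \<times> ('v \<Rightarrow> 'm) \<Rightarrow> bool" where
  "rrb_hom A B f \<longleftrightarrow>
     Vector_Spaces.linear (lsc A) (lsc B) (fst f) \<and>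
     Vector_Spaces.linear (msc A) (msc B) (snd f) \<and>
     (\<forall>x y. fst f (brk A x y) = brk B (fst f x) (fst f y)) \<and>
     (\<forall>v. rbo B (snd f v) = fst f (rbo A v)) \<and>
     (\<forall>x v. snd f (act A x v) = act B (fst f x) (snd f v))"

definition derivations ::
    "('k::field, 'a::ab_group_add, 'v::ab_group_add) rrb_data \<Rightarrow> (('a \<Rightarrow> 'a) \<times> ('v \<Rightarrow> 'v)) set" where
  "derivations A = {(dA, dV).
     Vector_Spaces.linear (lsc A) (lsc A) dA \<and>
     Vector_Spaces.linear (msc A) (msc A) dV \<and>
     (\<forall>x y. dA (brk A x y) = brk A (dA x) y + brk A x (dA y)) \<and>
     (\<forall>v. rbo A (dV v) = dA (rbo A v)) \<and>
     (\<forall>x v. dV (act A x v) = act A x (dV v) + act A (dA x) v)}"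

definition endomorphisms ::
    "('k::field, 'b::ab_group_add, 'm::ab_group_add) rrb_data \<Rightarrow> (('b \<Rightarrow> 'b) \<times> ('m \<Rightarrow> 'm)) set" where
  "endomorphisms B = {(dB, dM).
     Vector_Spaces.linear (lsc B) (lsc B) dB \<and> Vector_Spaces.linear (msc B) (msc B) dM}"

section \<open>Abelian extensions\<close>

definition short_exact :: "('x::zero \<Rightarrow> 'y::zero) \<Rightarrow> ('y \<Rightarrow> 'z::zero) \<Rightarrow> bool" where
  "short_exact f g \<longleftrightarrow> inj f \<and> range f = {y. g y = 0} \<and> surj g"

definition abelian_extension ::
    "('k::field, 'a::ab_group_add, 'v::ab_group_add) rrb_data \<Rightarrow>
     ('k, 'b::ab_group_add, 'm::ab_group_add) rrb_data \<Rightarrow>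
     ('k, 'e::ab_group_add, 'w::ab_group_add) rrb_data \<Rightarrow>
     ('b \<Rightarrow> 'e) \<times> ('m \<Rightarrow> 'w) \<Rightarrow> ('e \<Rightarrow> 'a) \<times> ('w \<Rightarrow> 'v) \<Rightarrow> bool" where
  "abelian_extension A B E i p \<longleftrightarrow>
     rrb_abelian B \<and> rel_rota_baxter E \<and>
     rrb_hom B E i \<and> rrb_hom E A p \<and>
     short_exact (fst i) (fst p) \<and> short_exact (snd i) (snd p)"

definition extension_section ::
    "('k::field, 'a::ab_group_add, 'v::ab_group_add) rrb_data \<Rightarrow>
     ('k, 'e::ab_group_add, 'w::ab_group_add) rrb_data \<Rightarrow>
     ('e \<Rightarrow> 'a) \<times> ('w \<Rightarrow> 'v) \<Rightarrow> ('a \<Rightarrow> 'e) \<times> ('v \<Rightarrow> 'w) \<Rightarrow> bool" where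
  "extension_section A E p s \<longleftrightarrow>
     Vector_Spaces.linear (lsc A) (lsc E) (fst s) \<and>
     Vector_Spaces.linear (msc A) (msc E) (snd s) \<and>
     fst p \<circ> fst s = id \<and> snd p \<circ> snd s = id"

text \<open>
  The maps induced by a section.  The spaces \<open>B\<close> and \<open>M\<close> are identified with their images under the
  injections \<open>fst i\<close> and \<open>snd i\<close>: an element of \<open>B\<close> enters \<open>E\<close> through \<open>fst i\<close>, and \<open>inv (fst i)\<close>
  reads an element of the image as an element of \<open>B\<close> (similarly for \<open>M\<close>).
\<close>

definition ext_omega ::
    "('k, 'a, 'v) rrb_data \<Rightarrow> ('k, 'e::ab_group_add, 'w::ab_group_add) rrb_data \<Rightarrow>
     ('b \<Rightarrow> 'e) \<times> ('m \<Rightarrow> 'w) \<Rightarrow> ('a \<Rightarrow> 'e) \<times> ('v \<Rightarrow> 'w) \<Rightarrow> 'a \<Rightarrow> 'a \<Rightarrow> 'b" where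
  "ext_omega A E i s x y = inv (fst i) (brk E (fst s x) (fst s y) - fst s (brk A x y))"

definition ext_varpi ::
    "('k, 'a, 'v) rrb_data \<Rightarrow> ('k, 'e::ab_group_add, 'w::ab_group_add) rrb_data \<Rightarrow>
     ('b \<Rightarrow> 'e) \<times> ('m \<Rightarrow> 'w) \<Rightarrow> ('a \<Rightarrow> 'e) \<times> ('v \<Rightarrow> 'w) \<Rightarrow> 'a \<Rightarrow> 'v \<Rightarrow> 'm" where
  "ext_varpi A E i s x v = inv (snd i) (act E (fst s x) (snd s v) - snd s (act A x v))"

definition ext_chi ::
    "('k, 'a, 'v) rrb_data \<Rightarrow> ('k, 'e::ab_group_add, 'w::ab_group_add) rrb_data \<Rightarrow>
     ('b \<Rightarrow> 'e) \<times> ('m \<Rightarrow> 'w) \<Rightarrow> ('a \<Rightarrow> 'e) \<times> ('v \<Rightarrow> 'w) \<Rightarrow> 'v \<Rightarrow> 'b" where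
  "ext_chi A E i s v = inv (fst i) (rbo E (snd s v) - fst s (rbo A v))"

text \<open>The structure maps \<open>\<rho>\<^sub>B\<close>, \<open>\<rho>\<^sub>M\<close>, \<open>\<mu>\<close> of the coefficients.\<close>

record ('a, 'v, 'b, 'm) coeffs =
  rhoB :: "'a \<Rightarrow> 'b \<Rightarrow> 'b"
  rhoM :: "'a \<Rightarrow> 'm \<Rightarrow> 'm"
  mu :: "'v \<Rightarrow> 'b \<Rightarrow> 'm"

definition ext_coeffs ::
    "('k, 'e::ab_group_add, 'w::ab_group_add) rrb_data \<Rightarrow> ('b \<Rightarrow> 'e) \<times> ('m \<Rightarrow> 'w) \<Rightarrow>
     ('a \<Rightarrow> 'e) \<times> ('v \<Rightarrow> 'w) \<Rightarrow> ('a, 'v, 'b, 'm) coeffs" where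
  "ext_coeffs E i s =
     \<lparr>rhoB = (\<lambda>x a. inv (fst i) (brk E (fst s x) (fst i a))),
      rhoM = (\<lambda>x m. inv (snd i) (act E (fst s x) (snd i m))),
      mu = (\<lambda>v a. inv (snd i) (- act E (fst i a) (snd s v)))\<rparr>"

section \<open>Cohomology\<close>

definition Z1 ::
    "('k::field, 'a::ab_group_add, 'v::ab_group_add) rrb_data \<Rightarrow>
     ('k, 'b::ab_group_add, 'm::ab_group_add) rrb_data \<Rightarrow>
     ('a, 'v, 'b, 'm) coeffs \<Rightarrow> (('a \<Rightarrow> 'b) \<times> ('v \<Rightarrow> 'm)) set" where
  "Z1 A B C = {(fB, fM).
     Vector_Spaces.linear (lsc A) (lsc B) fB \<and>
     Vector_Spaces.linear (msc A) (msc B) fM \<and>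
     (\<forall>x y. rhoB C x (fB y) - rhoB C y (fB x) = fB (brk A x y)) \<and>
     (\<forall>x v. mu C v (fB x) + fM (act A x v) = rhoM C x (fM v)) \<and>
     (\<forall>v. fB (rbo A v) = rbo B (fM v))}"

definition Z2 ::
    "('k::field, 'a::ab_group_add, 'v::ab_group_add) rrb_data \<Rightarrow>
     ('k, 'b::ab_group_add, 'm::ab_group_add) rrb_data \<Rightarrow>
     ('a, 'v, 'b, 'm) coeffs \<Rightarrow> (('a \<Rightarrow> 'a \<Rightarrow> 'b) \<times> ('a \<Rightarrow> 'v \<Rightarrow> 'm) \<times> ('v \<Rightarrow> 'b)) set" where
  "Z2 A B C = {(fB, fM, th).
     bilinear_map (lsc A) (lsc A) (lsc B) fB \<and> (\<forall>x. fB x x = 0) \<and>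
     bilinear_map (lsc A) (msc A) (msc B) fM \<and>
     Vector_Spaces.linear (msc A) (lsc B) th \<and>
     (\<forall>x y z.
        rhoB C x (fB y z) - rhoB C y (fB x z) + rhoB C z (fB x y)
        - fB (brk A x y) z + fB (brk A x z) y - fB (brk A y z) x = 0) \<and>
     (\<forall>x y v.
        - fM (brk A x y) v + mu C v (fB x y) + rhoM C x (fM y v) - rhoM C y (fM x v)
        - fM y (act A x v) + fM x (act A y v) = 0) \<and>
     (\<forall>v1 v2.
        rhoB C (rbo A v1) (th v2) - rhoB C (rbo A v2) (th v1)
        - rbo B (mu C v1 (th v2) - mu C v2 (th v1))
        - th (act A (rbo A v1) v2 - act A (rbo A v2) v1)
        + fB (rbo A v1) (rbo A v2)
        - rbo B (fM (rbo A v1) v2 - fM (rbo A v2) v1) = 0)}"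

definition coboundary ::
    "('k, 'a, 'v) rrb_data \<Rightarrow> ('k, 'b::ab_group_add, 'm::ab_group_add) rrb_data \<Rightarrow>
     ('a, 'v, 'b, 'm) coeffs \<Rightarrow> ('a \<Rightarrow> 'b) \<times> ('v \<Rightarrow> 'm) \<Rightarrow>
     ('a \<Rightarrow> 'a \<Rightarrow> 'b) \<times> ('a \<Rightarrow> 'v \<Rightarrow> 'm) \<times> ('v \<Rightarrow> 'b)" where
  "coboundary A B C = (\<lambda>(fB, fM).
     ((\<lambda>x y. rhoB C x (fB y) - rhoB C y (fB x) - fB (brk A x y)),
      (\<lambda>x v. - mu C v (fB x) + rhoM C x (fM v) - fM (act A x v)),
      (\<lambda>v. - fB (rbo A v) + rbo B (fM v))))"

definition B2 ::
    "('k::field, 'a::ab_group_add, 'v::ab_group_add) rrb_data \<Rightarrow>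
     ('k, 'b::ab_group_add, 'm::ab_group_add) rrb_data \<Rightarrow>
     ('a, 'v, 'b, 'm) coeffs \<Rightarrow> (('a \<Rightarrow> 'a \<Rightarrow> 'b) \<times> ('a \<Rightarrow> 'v \<Rightarrow> 'm) \<times> ('v \<Rightarrow> 'b)) set" where
  "B2 A B C = coboundary A B C ` {(fB, fM).
     Vector_Spaces.linear (lsc A) (lsc B) fB \<and> Vector_Spaces.linear (msc A) (msc B) fM}"

definition Z1_space ::
    "('k::field, 'a::ab_group_add, 'v::ab_group_add) rrb_data \<Rightarrow>
     ('k, 'b::ab_group_add, 'm::ab_group_add) rrb_data \<Rightarrow>
     ('a, 'v, 'b, 'm) coeffs \<Rightarrow> ('k, ('a \<Rightarrow> 'b) \<times> ('v \<Rightarrow> 'm)) vspace" where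
  "Z1_space A B C = sub_vspace (prod_scale (fun_scale (lsc B)) (fun_scale (msc B))) (Z1 A B C)"

definition H2_space ::
    "('k::field, 'a::ab_group_add, 'v::ab_group_add) rrb_data \<Rightarrow>
     ('k, 'b::ab_group_add, 'm::ab_group_add) rrb_data \<Rightarrow>
     ('a, 'v, 'b, 'm) coeffs \<Rightarrow>
     ('k, (('a \<Rightarrow> 'a \<Rightarrow> 'b) \<times> ('a \<Rightarrow> 'v \<Rightarrow> 'm) \<times> ('v \<Rightarrow> 'b)) set) vspace" where
  "H2_space A B C =
     quotient_vspace
       (prod_scale (fun_scale (fun_scale (lsc B)))
         (prod_scale (fun_scale (fun_scale (msc B))) (fun_scale (lsc B))))
       (Z2 A B C) (B2 A B C)"

section \<open>The remaining terms and the maps of the Wells sequence\<close>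

definition ext_derivations ::
    "('k::field, 'e::ab_group_add, 'w::ab_group_add) rrb_data \<Rightarrow> ('b \<Rightarrow> 'e) \<times> ('m \<Rightarrow> 'w) \<Rightarrow>
     (('e \<Rightarrow> 'e) \<times> ('w \<Rightarrow> 'w)) set" where
  "ext_derivations E i = {(dE, dW) \<in> derivations E.
     dE ` range (fst i) \<subseteq> range (fst i) \<and> dW ` range (snd i) \<subseteq> range (snd i)}"

definition ext_derivations_space ::
    "('k::field, 'e::ab_group_add, 'w::ab_group_add) rrb_data \<Rightarrow> ('b \<Rightarrow> 'e) \<times> ('m \<Rightarrow> 'w) \<Rightarrow>
     ('k, ('e \<Rightarrow> 'e) \<times> ('w \<Rightarrow> 'w)) vspace" where
  "ext_derivations_space E i =
     sub_vspace (prod_scale (fun_scale (lsc E)) (fun_scale (msc E))) (ext_derivations E i)"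

definition compatible_pairs ::
    "('k::field, 'a::ab_group_add, 'v::ab_group_add) rrb_data \<Rightarrow>
     ('k, 'b::ab_group_add, 'm::ab_group_add) rrb_data \<Rightarrow>
     ('a, 'v, 'b, 'm) coeffs \<Rightarrow>
     ((('a \<Rightarrow> 'a) \<times> ('v \<Rightarrow> 'v)) \<times> (('b \<Rightarrow> 'b) \<times> ('m \<Rightarrow> 'm))) set" where
  "compatible_pairs A B C = {((dA, dV), (dB, dM)).
     (dA, dV) \<in> derivations A \<and> (dB, dM) \<in> endomorphisms B \<and>
     (\<forall>x m. dM (rhoM C x m) = rhoM C x (dM m) + rhoM C (dA x) m) \<and>
     (\<forall>x a. dB (rhoB C x a) = rhoB C x (dB a) + rhoB C (dA x) a) \<and>
     (\<forall>v a. dM (mu C v a) = mu C (dV v) a + mu C v (dB a)) \<and>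
     (\<forall>m. dB (rbo B m) = rbo B (dM m))}"

definition compatible_pairs_space ::
    "('k::field, 'a::ab_group_add, 'v::ab_group_add) rrb_data \<Rightarrow>
     ('k, 'b::ab_group_add, 'm::ab_group_add) rrb_data \<Rightarrow>
     ('a, 'v, 'b, 'm) coeffs \<Rightarrow>
     ('k, (('a \<Rightarrow> 'a) \<times> ('v \<Rightarrow> 'v)) \<times> (('b \<Rightarrow> 'b) \<times> ('m \<Rightarrow> 'm))) vspace" where
  "compatible_pairs_space A B C =
     sub_vspace
       (prod_scale (prod_scale (fun_scale (lsc A)) (fun_scale (msc A)))
         (prod_scale (fun_scale (lsc B)) (fun_scale (msc B))))
       (compatible_pairs A B C)"

text \<open>The pair of maps below is unique, since for a section \<open>s\<close> every element of \<open>E\<close> is uniquely of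
  the form \<open>s x + i a\<close> in both components.\<close>

definition wells_iota ::
    "('b \<Rightarrow> 'e::ab_group_add) \<times> ('m \<Rightarrow> 'w::ab_group_add) \<Rightarrow> ('a \<Rightarrow> 'e) \<times> ('v \<Rightarrow> 'w) \<Rightarrow>
     ('a \<Rightarrow> 'b) \<times> ('v \<Rightarrow> 'm) \<Rightarrow> ('e \<Rightarrow> 'e) \<times> ('w \<Rightarrow> 'w)" where
  "wells_iota i s f = (THE d.
     (\<forall>x a. fst d (fst s x + fst i a) = fst i (fst f x)) \<and>
     (\<forall>v m. snd d (snd s v + snd i m) = snd i (snd f v)))"

definition wells_F ::
    "('b \<Rightarrow> 'e) \<times> ('m \<Rightarrow> 'w) \<Rightarrow> ('e \<Rightarrow> 'a) \<times> ('w \<Rightarrow> 'v) \<Rightarrow> ('a \<Rightarrow> 'e) \<times> ('v \<Rightarrow> 'w) \<Rightarrow>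
     ('e \<Rightarrow> 'e) \<times> ('w \<Rightarrow> 'w) \<Rightarrow> (('a \<Rightarrow> 'a) \<times> ('v \<Rightarrow> 'v)) \<times> (('b \<Rightarrow> 'b) \<times> ('m \<Rightarrow> 'm))" where
  "wells_F i p s d =
     ((fst p \<circ> fst d \<circ> fst s, snd p \<circ> snd d \<circ> snd s),
      (inv (fst i) \<circ> fst d \<circ> fst i, inv (snd i) \<circ> snd d \<circ> snd i))"

definition wells_cocycle ::
    "('k, 'a, 'v) rrb_data \<Rightarrow> ('k, 'e::ab_group_add, 'w::ab_group_add) rrb_data \<Rightarrow>
     ('b::ab_group_add \<Rightarrow> 'e) \<times> ('m::ab_group_add \<Rightarrow> 'w) \<Rightarrow> ('a \<Rightarrow> 'e) \<times> ('v \<Rightarrow> 'w) \<Rightarrow>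
     (('a \<Rightarrow> 'a) \<times> ('v \<Rightarrow> 'v)) \<times> (('b \<Rightarrow> 'b) \<times> ('m \<Rightarrow> 'm)) \<Rightarrow>
     ('a \<Rightarrow> 'a \<Rightarrow> 'b) \<times> ('a \<Rightarrow> 'v \<Rightarrow> 'm) \<times> ('v \<Rightarrow> 'b)" where
  "wells_cocycle A E i s = (\<lambda>((dA, dV), (dB, dM)).
     ((\<lambda>x y. dB (ext_omega A E i s x y) - ext_omega A E i s (dA x) y - ext_omega A E i s x (dA y)),
      (\<lambda>x v. dM (ext_varpi A E i s x v) - ext_varpi A E i s (dA x) v - ext_varpi A E i s x (dV v)),
      (\<lambda>v. dB (ext_chi A E i s v) - ext_chi A E i s (dV v))))"

definition wells_map ::
    "('k::field, 'a::ab_group_add, 'v::ab_group_add) rrb_data \<Rightarrow>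
     ('k, 'b::ab_group_add, 'm::ab_group_add) rrb_data \<Rightarrow>
     ('k, 'e::ab_group_add, 'w::ab_group_add) rrb_data \<Rightarrow>
     ('b \<Rightarrow> 'e) \<times> ('m \<Rightarrow> 'w) \<Rightarrow> ('a \<Rightarrow> 'e) \<times> ('v \<Rightarrow> 'w) \<Rightarrow>
     (('a \<Rightarrow> 'a) \<times> ('v \<Rightarrow> 'v)) \<times> (('b \<Rightarrow> 'b) \<times> ('m \<Rightarrow> 'm)) \<Rightarrow>
     (('a \<Rightarrow> 'a \<Rightarrow> 'b) \<times> ('a \<Rightarrow> 'v \<Rightarrow> 'm) \<times> ('v \<Rightarrow> 'b)) set" where
  "wells_map A B E i s d = coset (B2 A B (ext_coeffs E i s)) (wells_cocycle A E i s d)"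

end

theory Submission
  imports Defs
begin

text \<open>
  The section writes every element of the extension uniquely as \<open>s x + i a\<close>, so the extension is
  \<open>A \<oplus> B\<close> (and \<open>V \<oplus> M\<close>) with operations twisted by \<open>(\<omega>, \<varpi>, \<chi>)\<close>, and the axioms of a relative
  Rota-Baxter Lie algebra for it contain the module identities of the coefficients and the cocycle
  condition for \<open>(\<omega>, \<varpi>, \<chi>)\<close>.  A pair of maps preserving \<open>B\<close> and \<open>M\<close> is block triangular,
  \<open>s x + i a \<mapsto> s (d\<^sub>A x) + i (f x + d\<^sub>B a)\<close>, and it is a derivation iff the diagonal \<open>d\<close> is a
  compatible pair and the off-diagonal part \<open>f\<close> satisfies \<open>\<delta> f =\<close> (Wells cocycle of \<open>d\<close>).  Exactness
  is read off from this equivalence: \<open>\<iota>\<close> inserts \<open>f\<close> with \<open>d = 0\<close>, and \<open>F\<close> forgets \<open>f\<close>.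
\<close>

section \<open>Vector spaces\<close>

lemma linear_map_add: "Vector_Spaces.linear s1 s2 f \<Longrightarrow> f (x + y) = f x + f y"
  and linear_map_scale: "Vector_Spaces.linear s1 s2 f \<Longrightarrow> f (s1 c x) = s2 c (f x)"
  unfolding Vector_Spaces.linear_iff by blast+

lemma linear_map_0: "Vector_Spaces.linear s1 s2 f \<Longrightarrow> f 0 = 0"
  and linear_map_diff: "Vector_Spaces.linear s1 s2 f \<Longrightarrow> f (x - y) = f x - f y"
  and linear_map_neg: "Vector_Spaces.linear s1 s2 f \<Longrightarrow> f (- x) = - f x"
  by (simp_all add: linear_iff_module_hom module_hom.zero module_hom.diff module_hom.neg)

lemmas linear_map_simps = linear_map_add linear_map_0 linear_map_diff linear_map_neg linear_map_scale

lemma bilinear_right: "bilinear_map sx sy sz f \<Longrightarrow> Vector_Spaces.linear sy sz (f x)"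
  and bilinear_left: "bilinear_map sx sy sz f \<Longrightarrow> Vector_Spaces.linear sx sz (\<lambda>x. f x y)"
  by (simp_all add: bilinear_map_def)

lemma bilinear_simps:
  assumes "bilinear_map sx sy sz f"
  shows "f (x + x') y = f x y + f x' y" "f (x - x') y = f x y - f x' y"
    "f (- x) y = - f x y" "f 0 y = 0" "f (sx c x) y = sz c (f x y)"
    "f x (y + y') = f x y + f x y'" "f x (y - y') = f x y - f x y'"
    "f x (- y) = - f x y" "f x 0 = 0" "f x (sy c y) = sz c (f x y)"
  using linear_map_simps[OF bilinear_left[OF assms]] linear_map_simps[OF bilinear_right[OF assms]]
  by simp_all

text \<open>Polarisation of \<open>f (x + y) (x + y) = 0\<close>; this direction holds in every
  characteristic, including 2.\<close>

lemma alternating_swap: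
  assumes "bilinear_map sx sx sz f" "\<And>x. f x x = 0"
  shows "f x y = - f y x"
proof -
  have "f (x + y) (x + y) = (f x x + f y x) + (f x y + f y y)"
    by (simp only: bilinear_simps(1,6)[OF assms(1)])
  then show ?thesis
    by (simp add: assms(2) eq_neg_iff_add_eq_0 add.commute)
qed

text \<open>\<open>Vector_Spaces.linear\<close> contains the vector space axioms of both sides. With
  these split off as hypotheses, bilinearity is a list of equations that \<open>simp\<close> can
  check.\<close>

lemma bilinear_iff:
  assumes "vector_space sx" "vector_space sy" "vector_space sz"
  shows "bilinear_map sx sy sz f \<longleftrightarrow>
    (\<forall>x x' y. f (x + x') y = f x y + f x' y) \<and> (\<forall>x y y'. f x (y + y') = f x y + f x y') \<and>
    (\<forall>c x y. f (sx c x) y = sz c (f x y)) \<and> (\<forall>c x y. f x (sy c y) = sz c (f x y))"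
  using assms by (auto simp: bilinear_map_def Vector_Spaces.linear_iff)

lemma vector_space_simps:
  assumes "vector_space sc"
  shows "sc c (x + y) = sc c x + sc c y" "sc c (x - y) = sc c x - sc c y" "sc c (- x) = - sc c x"
    "sc c 0 = 0" "sc (c + d) x = sc c x + sc d x" "sc c (sc d x) = sc (c * d) x" "sc 1 x = x"
    "sc 0 x = 0"
proof -
  interpret vector_space sc by fact
  show "sc c (x + y) = sc c x + sc c y" "sc c (x - y) = sc c x - sc c y" "sc c (- x) = - sc c x"
    "sc c 0 = 0" "sc (c + d) x = sc c x + sc d x" "sc c (sc d x) = sc (c * d) x" "sc 1 x = x"
    "sc 0 x = 0"
    by (simp_all add: scale_right_distrib scale_right_diff_distrib scale_left_distrib)
qed

section \<open>Function spaces, product spaces and subspaces\<close>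

lemma vector_space_fun_scale:
  assumes "vector_space sc"
  shows "vector_space (fun_scale sc)"
  by unfold_locales (auto simp: fun_scale_def vector_space_simps[OF assms])

lemma vector_space_prod_scale:
  assumes "vector_space sc" "vector_space sc'"
  shows "vector_space (prod_scale sc sc')"
  by unfold_locales (auto simp: prod_scale_def assms[THEN vector_space_simps(1)]
      assms[THEN vector_space_simps(5)] assms[THEN vector_space_simps(6)]
      assms[THEN vector_space_simps(7)])

lemma subspace_iff:
  "vector_space sc \<Longrightarrow> module.subspace sc S \<longleftrightarrow>
    0 \<in> S \<and> (\<forall>x\<in>S. \<forall>y\<in>S. x + y \<in> S) \<and> (\<forall>c. \<forall>x\<in>S. sc c x \<in> S)"
  by (simp add: module_iff_vector_space module.subspace_def)

lemma subspace_closed: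
  assumes "vector_space sc" "module.subspace sc S"
  shows "0 \<in> S" "x \<in> S \<Longrightarrow> y \<in> S \<Longrightarrow> x + y \<in> S" "x \<in> S \<Longrightarrow> sc c x \<in> S"
    "x \<in> S \<Longrightarrow> - x \<in> S"
  using assms module.subspace_neg[of sc S]
  by (simp_all add: subspace_iff[OF assms(1)] module_iff_vector_space)

lemma is_vspace_sub_vspace:
  assumes "vector_space sc" "module.subspace sc S"
  shows "is_vspace (sub_vspace sc S)"
proof -
  note closed = subspace_closed[OF assms]
  have "\<exists>y\<in>S. x + y = 0" if "x \<in> S" for x
    using closed(4)[OF that] by (intro bexI[of _ "- x"]) auto
  then show ?thesis
    by (auto simp: is_vspace_def sub_vspace_def closed vector_space_simps[OF assms(1)] add_ac)
qed

section \<open>Cosets and quotient spaces\<close>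

lemma coset_memI: "n \<in> N \<Longrightarrow> z + n \<in> coset N z"
  by (auto simp: coset_def)

text \<open>Cosets are added elementwise, so compatibility with representatives is a set equality;
  it rests on \<open>N\<close> being closed under addition and containing 0.\<close>

lemma coset_add:
  assumes "vector_space sc" "module.subspace sc N"
  shows "{x + y | x y. x \<in> coset N z \<and> y \<in> coset N w} = coset N (z + w)"
proof (intro equalityI subsetI)
  fix u assume "u \<in> {x + y | x y. x \<in> coset N z \<and> y \<in> coset N w}"
  then obtain n n' where u: "u = (z + n) + (w + n')" "n \<in> N" "n' \<in> N"
    unfolding coset_def by blast
  from coset_memI[OF subspace_closed(2)[OF assms u(2,3)], of "z + w"]
  show "u \<in> coset N (z + w)"
    by (simp add: u(1) add_ac)
next
  fix u assume "u \<in> coset N (z + w)"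
  then obtain n where u: "u = (z + w) + n" "n \<in> N"
    unfolding coset_def by blast
  have "z + n \<in> coset N z" "w + 0 \<in> coset N w"
    by (rule coset_memI, fact)+ (rule coset_memI, rule subspace_closed(1)[OF assms])
  moreover have "u = (z + n) + (w + 0)"
    by (simp add: u(1) add_ac)
  ultimately show "u \<in> {x + y | x y. x \<in> coset N z \<and> y \<in> coset N w}"
    by blast
qed

lemma coset_scale:
  assumes "vector_space sc" "module.subspace sc N"
  shows "{sc c x + n | x n. x \<in> coset N z \<and> n \<in> N} = coset N (sc c z)"
proof (intro equalityI subsetI)
  note closed = subspace_closed[OF assms]
  fix u assume "u \<in> {sc c x + n | x n. x \<in> coset N z \<and> n \<in> N}"
  then obtain n n' where u: "u = sc c (z + n) + n'" "n \<in> N" "n' \<in> N"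
    unfolding coset_def by blast
  from coset_memI[OF closed(2)[OF closed(3)[OF u(2)] u(3)], of "sc c z" c]
  show "u \<in> coset N (sc c z)"
    by (simp add: u(1) vector_space_simps(1)[OF assms(1)] add_ac)
next
  fix u assume "u \<in> coset N (sc c z)"
  \<comment> \<open>The coset element is taken to be \<open>z\<close> itself, written
    \<open>z + 0\<close>, so that all of \<open>n\<close> sits in the extra summand. This also
    covers the scalar 0.\<close>
  then obtain n where "u = sc c (z + 0) + n" "n \<in> N"
    by (auto simp: coset_def)
  moreover have "z + 0 \<in> coset N z"
    by (rule coset_memI, rule subspace_closed(1)[OF assms])
  ultimately show "u \<in> {sc c x + n | x n. x \<in> coset N z \<and> n \<in> N}"
    by blast
qed

text \<open>Turns the vanishing of a class in the quotient into membership in \<open>N\<close>; for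
  the Wells map this is membership in \<open>B2\<close>.\<close>

lemma coset_eq_self_iff:
  assumes "vector_space sc" "module.subspace sc N"
  shows "coset N z = N \<longleftrightarrow> z \<in> N"
proof
  assume "coset N z = N"
  then show "z \<in> N"
    using coset_memI[OF subspace_closed(1)[OF assms], of z] by simp
next
  note closed = subspace_closed[OF assms]
  assume z: "z \<in> N"
  show "coset N z = N"
  proof (intro equalityI subsetI)
    fix u assume "u \<in> coset N z"
    then show "u \<in> N"
      using closed(2)[OF z] by (auto simp: coset_def)
  next
    fix u assume "u \<in> N"
    from coset_memI[OF closed(2)[OF closed(4)[OF z] this], of z]
    show "u \<in> coset N z" by simp
  qed
qed

text \<open>All operations act on representatives, so the axioms of the quotient reduce to those of
  the ambient vector space.\<close>

lemma quotient_vspace_ops: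
  assumes "vector_space sc" "module.subspace sc N"
  shows "vcarrier (quotient_vspace sc Z N) = coset N ` Z"
    "vadd (quotient_vspace sc Z N) (coset N z) (coset N w) = coset N (z + w)"
    "vzero (quotient_vspace sc Z N) = coset N 0"
    "vscale (quotient_vspace sc Z N) c (coset N z) = coset N (sc c z)"
  using coset_add[OF assms, of z w] coset_scale[OF assms, of c z]
    coset_eq_self_iff[OF assms, of 0] subspace_closed(1)[OF assms]
  by (simp_all add: quotient_vspace_def)

lemma is_vspace_quotient_vspace:
  assumes "vector_space sc" "module.subspace sc Z" "module.subspace sc N"
  shows "is_vspace (quotient_vspace sc Z N)"
proof -
  note closed = subspace_closed[OF assms(1,2)]
  have inv: "\<exists>y\<in>Z. coset N (z + y) = coset N 0" if "z \<in> Z" for z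
    using closed(4)[OF that] by (intro bexI[of _ "- z"]) simp_all
  show ?thesis
    by (simp add: is_vspace_def quotient_vspace_ops[OF assms(1,3)] closed inv
        vector_space_simps[OF assms(1)] add_ac)
qed

section \<open>Linear maps between carriers, and ways to build subspaces\<close>

lemma vhom_sub_vspace_iff:
  "f \<in> vhom (sub_vspace sc S) (sub_vspace sc' S') \<longleftrightarrow>
     (\<forall>x\<in>S. f x \<in> S') \<and> (\<forall>x\<in>S. \<forall>y\<in>S. f (x + y) = f x + f y) \<and>
     (\<forall>c. \<forall>x\<in>S. f (sc c x) = sc' c (f x))"
  by (simp add: vhom_def sub_vspace_def)

lemma vhom_coset:
  assumes "vector_space sc'" "module.subspace sc' N"
    and "f \<in> vhom (sub_vspace sc S) (sub_vspace sc' Z)"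
  shows "(\<lambda>x. coset N (f x)) \<in> vhom (sub_vspace sc S) (quotient_vspace sc' Z N)"
  using assms(3) unfolding vhom_sub_vspace_iff
  by (simp add: vhom_def sub_vspace_def quotient_vspace_ops[OF assms(1,2)])

text \<open>Commutativity of the field enters here: a scalar multiple of a linear map is homogeneous
  because scalars commute.\<close>

lemma subspace_linear_maps:
  assumes "vector_space s1" "vector_space s2"
  shows "module.subspace (fun_scale s2) {f. Vector_Spaces.linear s1 s2 f}"
  using vector_space_simps[OF assms(2)] assms
  by (auto simp: subspace_iff vector_space_fun_scale Vector_Spaces.linear_iff fun_scale_def
      mult.commute add_ac)

lemma subspace_Times:
  assumes "vector_space sc" "vector_space sc'"
    and "module.subspace sc S" "module.subspace sc' S'"
  shows "module.subspace (prod_scale sc sc') (S \<times> S')"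
  using assms by (auto simp: subspace_iff vector_space_prod_scale prod_scale_def zero_prod_def)

lemma subspace_restrict:
  assumes "vector_space sc" "module.subspace sc S"
    and "P 0" "\<And>x y. P x \<Longrightarrow> P y \<Longrightarrow> P (x + y)" "\<And>c x. P x \<Longrightarrow> P (sc c x)"
  shows "module.subspace sc {x \<in> S. P x}"
  using assms by (simp add: subspace_iff)

text \<open>The map is additive and homogeneous on the whole type, as the cochain formulas below are
  for arbitrary functions; linearity of the arguments is kept in \<open>S\<close>.\<close>

lemma subspace_kernel:
  assumes "vector_space sc" "vector_space sc'" "module.subspace sc S"
    and "\<And>x y. f (x + y) = f x + f y" "\<And>c x. f (sc c x) = sc' c (f x)"
  shows "module.subspace sc {x \<in> S. f x = 0}"
proof (rule subspace_restrict[OF assms(1,3)])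
  show "f 0 = 0"
    using assms(4)[of 0 0] by simp
qed (simp_all add: assms(4,5) vector_space_simps(4)[OF assms(2)])

lemma subspace_image:
  assumes "vector_space sc" "vector_space sc'" "module.subspace sc S"
    and "\<And>x y. f (x + y) = f x + f y" "\<And>c x. f (sc c x) = sc' c (f x)"
  shows "module.subspace sc' (f ` S)"
proof -
  have "f 0 = 0"
    using assms(4)[of 0 0] by simp
  then have "0 \<in> f ` S"
    using subspace_closed(1)[OF assms(1,3)] by (metis imageI)
  then show ?thesis
    using assms(1,3)
    by (auto simp: subspace_iff[OF assms(2)] subspace_iff[OF assms(1)] assms(4,5)[symmetric])
qed

lemma subspace_derivations:
  assumes "rel_rota_baxter X"
  shows "module.subspace (prod_scale (fun_scale (lsc X)) (fun_scale (msc X))) (derivations X)"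
proof -
  have bil: "bilinear_map (lsc X) (lsc X) (lsc X) (brk X)"
    "bilinear_map (lsc X) (msc X) (msc X) (act X)"
    and lin: "Vector_Spaces.linear (msc X) (lsc X) (rbo X)"
    and vs: "vector_space (lsc X)" "vector_space (msc X)"
    using assms by (simp_all add: rel_rota_baxter_def lie_algebra_def lie_representation_def)
  note simps = linear_map_simps[OF lin] bilinear_simps[OF bil(1)] bilinear_simps[OF bil(2)]
    vector_space_simps[OF vs(1)] vector_space_simps[OF vs(2)]
  show ?thesis
    by (auto simp: subspace_iff vector_space_prod_scale vector_space_fun_scale vs derivations_def
        prod_scale_def fun_scale_def zero_prod_def Vector_Spaces.linear_iff simps mult.commute
        algebra_simps)
qed

section \<open>The extension in coordinates\<close>

locale rrb_split_extension =
  fixes A :: "('k::field, 'a::ab_group_add, 'v::ab_group_add) rrb_data"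
    and B :: "('k, 'b::ab_group_add, 'm::ab_group_add) rrb_data"
    and E :: "('k, 'e::ab_group_add, 'w::ab_group_add) rrb_data"
    and i :: "('b \<Rightarrow> 'e) \<times> ('m \<Rightarrow> 'w)"
    and p :: "('e \<Rightarrow> 'a) \<times> ('w \<Rightarrow> 'v)"
    and s :: "('a \<Rightarrow> 'e) \<times> ('v \<Rightarrow> 'w)"
  assumes A: "rel_rota_baxter A"
    and B: "rel_rota_baxter B"
    and ext: "abelian_extension A B E i p"
    and sec: "extension_section A E p s"
begin

abbreviation "C \<equiv> ext_coeffs E i s"
abbreviation "om \<equiv> ext_omega A E i s"
abbreviation "vp \<equiv> ext_varpi A E i s"
abbreviation "ch \<equiv> ext_chi A E i s"

text \<open>The coordinates given by the section: \<open>mkE\<close> and \<open>mkW\<close> are the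
  linear bijections from the sums of \<open>A\<close> and \<open>B\<close>, and of \<open>V\<close>
  and \<open>M\<close>, onto the two spaces of the extension.\<close>

definition "mkE x a = fst s x + fst i a"
definition "mkW v m = snd s v + snd i m"

lemma E: "rel_rota_baxter E"
  using ext by (simp add: abelian_extension_def)

lemma linear_maps:
  "Vector_Spaces.linear (lsc A) (lsc E) (fst s)" "Vector_Spaces.linear (msc A) (msc E) (snd s)"
  "Vector_Spaces.linear (lsc B) (lsc E) (fst i)" "Vector_Spaces.linear (msc B) (msc E) (snd i)"
  "Vector_Spaces.linear (lsc E) (lsc A) (fst p)" "Vector_Spaces.linear (msc E) (msc A) (snd p)"
  "Vector_Spaces.linear (msc A) (lsc A) (rbo A)" "Vector_Spaces.linear (msc B) (lsc B) (rbo B)"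
  "Vector_Spaces.linear (msc E) (lsc E) (rbo E)"
  using A B E ext sec
  by (simp_all add: extension_section_def abelian_extension_def rrb_hom_def rel_rota_baxter_def)

lemma vector_spaces:
  "vector_space (lsc A)" "vector_space (msc A)" "vector_space (lsc B)" "vector_space (msc B)"
  "vector_space (lsc E)" "vector_space (msc E)"
  using linear_maps unfolding Vector_Spaces.linear_iff by blast+

lemma bilinear_maps:
  "bilinear_map (lsc A) (lsc A) (lsc A) (brk A)" "bilinear_map (lsc A) (msc A) (msc A) (act A)"
  "bilinear_map (lsc E) (lsc E) (lsc E) (brk E)" "bilinear_map (lsc E) (msc E) (msc E) (act E)"
  using A E
  by (simp_all add: rel_rota_baxter_def lie_algebra_def lie_representation_def)

lemmas base_simps = linear_maps[THEN linear_map_add] linear_maps[THEN linear_map_0]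
  linear_maps[THEN linear_map_diff] linear_maps[THEN linear_map_neg] linear_maps[THEN linear_map_scale]
  bilinear_maps[THEN bilinear_simps(1)] bilinear_maps[THEN bilinear_simps(2)]
  bilinear_maps[THEN bilinear_simps(3)] bilinear_maps[THEN bilinear_simps(4)]
  bilinear_maps[THEN bilinear_simps(5)] bilinear_maps[THEN bilinear_simps(6)]
  bilinear_maps[THEN bilinear_simps(7)] bilinear_maps[THEN bilinear_simps(8)]
  bilinear_maps[THEN bilinear_simps(9)] bilinear_maps[THEN bilinear_simps(10)]

lemma inj_i: "inj (fst i)" "inj (snd i)"
  and range_i: "range (fst i) = {e. fst p e = 0}" "range (snd i) = {w. snd p w = 0}"
  and p_hom: "fst p (brk E e e') = brk A (fst p e) (fst p e')"
    "snd p (act E e w) = act A (fst p e) (snd p w)" "fst p (rbo E w) = rbo A (snd p w)"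
  and i_hom: "brk E (fst i a) (fst i a') = 0" "act E (fst i a) (snd i m) = 0"
    "rbo E (snd i m) = fst i (rbo B m)"
proof -
  show "inj (fst i)" "inj (snd i)"
    "range (fst i) = {e. fst p e = 0}" "range (snd i) = {w. snd p w = 0}"
    "fst p (brk E e e') = brk A (fst p e) (fst p e')"
    "snd p (act E e w) = act A (fst p e) (snd p w)" "fst p (rbo E w) = rbo A (snd p w)"
    "rbo E (snd i m) = fst i (rbo B m)"
    using ext by (auto simp: abelian_extension_def short_exact_def rrb_hom_def)
  \<comment> \<open>Abelianness enters here: \<open>i\<close> carries the zero bracket and zero
    action of \<open>B\<close> into the extension.\<close>
  have "brk E (fst i a) (fst i a') = fst i (brk B a a')"
    "act E (fst i a) (snd i m) = snd i (act B a m)"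
    "brk B a a' = 0" "act B a m = 0"
    using ext by (auto simp: abelian_extension_def rrb_abelian_def rrb_hom_def)
  then show "brk E (fst i a) (fst i a') = 0" "act E (fst i a) (snd i m) = 0"
    by (simp_all add: base_simps)
qed

lemma p_s [simp]: "fst p (fst s x) = x" "snd p (snd s v) = v"
  using sec by (simp_all add: extension_section_def pointfree_idE)

lemma p_i [simp]: "fst p (fst i a) = 0" "snd p (snd i m) = 0"
  using range_i by blast+

text \<open>By exactness the kernel of \<open>p\<close> is the image of \<open>i\<close>, so the
  inverses in the induced maps are genuine preimages there.\<close>

lemma i_inv_i: "fst p e = 0 \<Longrightarrow> fst i (inv (fst i) e) = e"
  "snd p w = 0 \<Longrightarrow> snd i (inv (snd i) w) = w"
  using range_i by (auto intro: f_inv_into_f)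

lemma brk_swap: "brk E e e' = - brk E e' e"
  using E by (intro alternating_swap[OF bilinear_maps(3)])
    (simp add: rel_rota_baxter_def lie_algebra_def)

text \<open>Each expression under \<open>inv\<close> is killed by \<open>p\<close>, since
  \<open>p\<close> is a homomorphism split by \<open>s\<close>. Applying \<open>i\<close> therefore
  removes the inverses from all induced maps.\<close>

lemma i_ext:
  "fst i (om x y) = brk E (fst s x) (fst s y) - fst s (brk A x y)"
  "fst i (rhoB C x a) = brk E (fst s x) (fst i a)"
  "snd i (vp x v) = act E (fst s x) (snd s v) - snd s (act A x v)"
  "snd i (rhoM C x m) = act E (fst s x) (snd i m)"
  "snd i (mu C v a) = - act E (fst i a) (snd s v)"
  "fst i (ch v) = rbo E (snd s v) - fst s (rbo A v)"
  by (simp_all add: ext_omega_def ext_varpi_def ext_chi_def ext_coeffs_def i_inv_i p_hom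
      base_simps)

lemma i_cancel: "a = b \<longleftrightarrow> fst i a = fst i b" "m = n \<longleftrightarrow> snd i m = snd i n"
  using inj_i by (simp_all add: inj_eq)

text \<open>The extension as a twisted product: expand all operations bilinearly, use that the image
  of \<open>B\<close> is abelian, and name the mixed terms. The signs at \<open>mu\<close> come from
  the minus sign in its definition, and that at \<open>rhoB C y a\<close> from antisymmetry.\<close>

lemma mk_ops:
  "mkE x a + mkE y b = mkE (x + y) (a + b)" "mkW v m + mkW u n = mkW (v + u) (m + n)"
  "mkE x a - mkE y b = mkE (x - y) (a - b)" "mkW v m - mkW u n = mkW (v - u) (m - n)"
  "lsc E c (mkE x a) = mkE (lsc A c x) (lsc B c a)"
  "msc E c (mkW v m) = mkW (msc A c v) (msc B c m)"
  "brk E (mkE x a) (mkE y b) = mkE (brk A x y) (om x y + rhoB C x b - rhoB C y a)"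
  "act E (mkE x a) (mkW v m) = mkW (act A x v) (vp x v + rhoM C x m - mu C v a)"
  "rbo E (mkW v m) = mkE (rbo A v) (ch v + rbo B m)"
  by (simp_all add: mkE_def mkW_def base_simps vector_space_simps[OF vector_spaces(5)]
      vector_space_simps[OF vector_spaces(6)] i_ext i_hom brk_swap[of "fst i a" "fst s y"] algebra_simps)

lemma p_mk [simp]: "fst p (mkE x a) = x" "snd p (mkW v m) = v"
  by (simp_all add: mkE_def mkW_def base_simps)

lemma mk_eq_iff [simp]: "mkE x a = mkE y b \<longleftrightarrow> x = y \<and> a = b"
  "mkW v m = mkW u n \<longleftrightarrow> v = u \<and> m = n"
proof -
  have "x = y" if "mkE x a = mkE y b" using that p_mk by metis
  then show "mkE x a = mkE y b \<longleftrightarrow> x = y \<and> a = b"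
    using inj_i by (auto simp: mkE_def dest: injD)
  have "v = u" if "mkW v m = mkW u n" using that p_mk by metis
  then show "mkW v m = mkW u n \<longleftrightarrow> v = u \<and> m = n"
    using inj_i by (auto simp: mkW_def dest: injD)
qed

lemma mk_0: "mkE 0 0 = 0" "mkW 0 0 = 0"
  by (simp_all add: mkE_def mkW_def base_simps)

lemma mk_eq_0_iff [simp]: "mkE x a = 0 \<longleftrightarrow> x = 0 \<and> a = 0" "mkW v m = 0 \<longleftrightarrow> v = 0 \<and> m = 0"
  using mk_eq_iff(1)[of x a 0 0] mk_eq_iff(2)[of v m 0 0] by (simp_all only: mk_0)

text \<open>The fibre coordinates, that is, the projections onto \<open>B\<close> and
  \<open>M\<close> along the section.\<close>

definition "qE e = inv (fst i) (e - fst s (fst p e))"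
definition "qW w = inv (snd i) (w - snd s (snd p w))"

lemma q_mk [simp]: "qE (mkE x a) = a" "qW (mkW v m) = m"
  using inj_i by (simp_all add: qE_def qW_def base_simps mkE_def mkW_def)

lemma mk_p_q: "mkE (fst p e) (qE e) = e" "mkW (snd p w) (qW w) = w"
  by (simp_all add: mkE_def mkW_def qE_def qW_def i_inv_i base_simps)

text \<open>As rewrite rules, these replace quantifiers over the extension by quantifiers over
  coordinates, where \<open>mk_ops\<close> applies.\<close>

lemma all_mk: "(\<forall>e. P e) \<longleftrightarrow> (\<forall>x a. P (mkE x a))" "(\<forall>w. Q w) \<longleftrightarrow> (\<forall>v m. Q (mkW v m))"
  using mk_p_q by metis+

lemma in_range_i: "e \<in> range (fst i) \<longleftrightarrow> fst p e = 0" "w \<in> range (snd i) \<longleftrightarrow> snd p w = 0"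
  by (simp_all add: range_i)

section \<open>The identities encoded in the extension\<close>

text \<open>Since \<open>i\<close> is injective, each identity may be checked after applying it;
  there it follows from the bilinearity of the operations of \<open>E\<close>.\<close>

lemma bilinear_ext:
  "bilinear_map (lsc A) (lsc B) (lsc B) (rhoB C)" "bilinear_map (lsc A) (msc B) (msc B) (rhoM C)"
  "bilinear_map (msc A) (lsc B) (msc B) (mu C)" "bilinear_map (lsc A) (lsc A) (lsc B) om"
  "bilinear_map (lsc A) (msc A) (msc B) vp"
  and linear_ch: "Vector_Spaces.linear (msc A) (lsc B) ch"
  by (simp_all only: bilinear_iff[OF vector_spaces(1,1,3)] bilinear_iff[OF vector_spaces(1,3,3)]
      bilinear_iff[OF vector_spaces(1,4,4)] bilinear_iff[OF vector_spaces(2,3,4)]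
      bilinear_iff[OF vector_spaces(1,2,4)] Vector_Spaces.linear_iff vector_spaces i_cancel)
    (simp_all add: i_ext base_simps vector_space_simps[OF vector_spaces(5)]
      vector_space_simps[OF vector_spaces(6)])

lemmas ext_simps = linear_map_simps[OF linear_ch]
  bilinear_ext[THEN bilinear_simps(1)] bilinear_ext[THEN bilinear_simps(2)]
  bilinear_ext[THEN bilinear_simps(3)] bilinear_ext[THEN bilinear_simps(4)]
  bilinear_ext[THEN bilinear_simps(5)] bilinear_ext[THEN bilinear_simps(6)]
  bilinear_ext[THEN bilinear_simps(7)] bilinear_ext[THEN bilinear_simps(8)]
  bilinear_ext[THEN bilinear_simps(9)] bilinear_ext[THEN bilinear_simps(10)]

section \<open>Axioms of \<open>E\<close> and \<open>A\<close>, and the identities they give for the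
  induced maps\<close>

lemma jacobi_E: "brk E e (brk E e' e'') + brk E e' (brk E e'' e) + brk E e'' (brk E e e') = 0"
  and rep_E: "act E (brk E e e') w = act E e (act E e' w) - act E e' (act E e w)"
  and rb_E: "brk E (rbo E u) (rbo E w) = rbo E (act E (rbo E u) w - act E (rbo E w) u)"
  and alt_E: "brk E e e = 0"
  using E by (simp_all add: rel_rota_baxter_def lie_algebra_def lie_representation_def)

lemma alt_A: "brk A x x = 0"
  and jacobi_A: "brk A (brk A x y) z = brk A x (brk A y z) - brk A y (brk A x z)"
  and swap_A: "brk A x y = - brk A y x"
  and rep_A: "act A (brk A x y) v = act A x (act A y v) - act A y (act A x v)"
  and rb_A: "brk A (rbo A u) (rbo A v) = rbo A (act A (rbo A u) v - act A (rbo A v) u)"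
proof -
  show "act A (brk A x y) v = act A x (act A y v) - act A y (act A x v)"
    "brk A (rbo A u) (rbo A v) = rbo A (act A (rbo A u) v - act A (rbo A v) u)"
    using A by (simp_all add: rel_rota_baxter_def lie_representation_def)
  have jac: "brk A x (brk A y z) + brk A y (brk A z x) + brk A z (brk A x y) = 0"
    and alt: "brk A x x = 0" for x y z
    using A by (simp_all add: rel_rota_baxter_def lie_algebra_def)
  show "brk A x x = 0" by (rule alt)
  have swap: "brk A x y = - brk A y x" for x y
    by (rule alternating_swap[OF bilinear_maps(1) alt])
  show "brk A x y = - brk A y x" by (rule swap)
  show "brk A (brk A x y) z = brk A x (brk A y z) - brk A y (brk A x z)"
  proof -
    \<comment> \<open>The cyclic Jacobi identity is brought into the form of a representation
      identity for the adjoint action, oriented like \<open>rep_A\<close> for rewriting.\<close>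
    have "brk A x (brk A y z) + brk A y (- brk A x z) + - brk A (brk A x y) z = 0"
      using jac[of x y z] unfolding swap[of z x] swap[of z "brk A x y"] .
    then show ?thesis
      by (simp add: base_simps algebra_simps)
  qed
qed

text \<open>The axioms of \<open>E\<close> are evaluated on arguments lying purely in the section or
  purely in the fibre. Apart from \<open>om x x = 0\<close>, the results say that the coefficients
  form a representation of \<open>A\<close>.\<close>

lemma coeff_identities:
  "om x x = 0"
  "rhoB C (brk A x y) a = rhoB C x (rhoB C y a) - rhoB C y (rhoB C x a)"
  "rhoM C (brk A x y) m = rhoM C x (rhoM C y m) - rhoM C y (rhoM C x m)"
  "mu C (act A x v) a = rhoM C x (mu C v a) - mu C v (rhoB C x a)"
  "rhoB C (rbo A v) (rbo B m) = rbo B (rhoM C (rbo A v) m + mu C v (rbo B m))"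
proof -
  show "om x x = 0"
    using alt_E[of "mkE x 0"] by (simp add: mk_ops ext_simps)
  show "rhoB C (brk A x y) a = rhoB C x (rhoB C y a) - rhoB C y (rhoB C x a)"
    using jacobi_E[of "mkE x 0" "mkE y 0" "mkE 0 a"]
    by (simp add: mk_ops ext_simps base_simps algebra_simps)
  show "rhoM C (brk A x y) m = rhoM C x (rhoM C y m) - rhoM C y (rhoM C x m)"
    using rep_E[of "mkE x 0" "mkE y 0" "mkW 0 m"]
    by (simp add: mk_ops ext_simps base_simps algebra_simps)
  show "mu C (act A x v) a = rhoM C x (mu C v a) - mu C v (rhoB C x a)"
    using rep_E[of "mkE x 0" "mkE 0 a" "mkW v 0"]
    by (simp add: mk_ops ext_simps base_simps algebra_simps)
  show "rhoB C (rbo A v) (rbo B m) = rbo B (rhoM C (rbo A v) m + mu C v (rbo B m))"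
    using rb_E[of "mkW v 0" "mkW 0 m"]
    by (simp add: mk_ops ext_simps base_simps algebra_simps)
qed

text \<open>On arguments in the section, the fibre components of the Jacobi, representation and
  Rota-Baxter identities of \<open>E\<close> are the three cocycle equations.\<close>

lemma ext_cocycle: "(om, vp, ch) \<in> Z2 A B C"
proof -
  have "rhoB C x (om y z) - rhoB C y (om x z) + rhoB C z (om x y)
      - om (brk A x y) z + om (brk A x z) y - om (brk A y z) x = 0" for x y z
  proof -
    have swap: "om x y = - om y x" for x y
      by (rule alternating_swap[OF bilinear_ext(4) coeff_identities(1)])
    show ?thesis
      \<comment> \<open>The Jacobi identity is cyclic while the cocycle equation is not; the
        instances of antisymmetry reconcile the two orders.\<close>
      using jacobi_E[of "mkE x 0" "mkE y 0" "mkE z 0"] swap[of z x] swap_A[of z x]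
        swap[of "brk A x y" z] swap[of "brk A x z" y] swap[of "brk A y z" x]
      by (simp add: mk_ops ext_simps base_simps algebra_simps)
  qed
  moreover have "- vp (brk A x y) v + mu C v (om x y) + rhoM C x (vp y v) - rhoM C y (vp x v)
        - vp y (act A x v) + vp x (act A y v) = 0" for x y v
    using rep_E[of "mkE x 0" "mkE y 0" "mkW v 0"]
    by (simp add: mk_ops ext_simps base_simps algebra_simps)
  moreover have "rhoB C (rbo A v1) (ch v2) - rhoB C (rbo A v2) (ch v1)
        - rbo B (mu C v1 (ch v2) - mu C v2 (ch v1))
        - ch (act A (rbo A v1) v2 - act A (rbo A v2) v1)
        + om (rbo A v1) (rbo A v2)
        - rbo B (vp (rbo A v1) v2 - vp (rbo A v2) v1) = 0" for v1 v2
    using rb_E[of "mkW v1 0" "mkW v2 0"]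
    by (simp add: mk_ops ext_simps base_simps algebra_simps)
  ultimately show ?thesis
    using bilinear_ext(4,5) linear_ch coeff_identities(1) unfolding Z2_def by blast
qed

text \<open>The differential squares to zero: after expansion everything cancels by the coefficient
  identities and the axioms of \<open>A\<close>.\<close>

lemma coboundary_in_Z2:
  assumes "Vector_Spaces.linear (lsc A) (lsc B) f" "Vector_Spaces.linear (msc A) (msc B) g"
  shows "coboundary A B C (f, g) \<in> Z2 A B C"
proof -
  note simps = assms[THEN linear_map_add] assms[THEN linear_map_0] assms[THEN linear_map_diff]
    assms[THEN linear_map_neg] assms[THEN linear_map_scale] ext_simps base_simps
    vector_space_simps[OF vector_spaces(3)] vector_space_simps[OF vector_spaces(4)]
  let ?f = "\<lambda>x y. rhoB C x (f y) - rhoB C y (f x) - f (brk A x y)"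
  let ?g = "\<lambda>x v. - mu C v (f x) + rhoM C x (g v) - g (act A x v)"
  let ?h = "\<lambda>v. - f (rbo A v) + rbo B (g v)"
  have "bilinear_map (lsc A) (lsc A) (lsc B) ?f" "bilinear_map (lsc A) (msc A) (msc B) ?g"
    by (simp_all add: bilinear_iff vector_spaces simps algebra_simps)
  moreover have "Vector_Spaces.linear (msc A) (lsc B) ?h"
    by (simp add: Vector_Spaces.linear_iff vector_spaces simps algebra_simps)
  moreover have "?f x x = 0" for x
    by (simp add: alt_A simps)
  moreover have "rhoB C x (?f y z) - rhoB C y (?f x z) + rhoB C z (?f x y)
      - ?f (brk A x y) z + ?f (brk A x z) y - ?f (brk A y z) x = 0" for x y z
  proof -
    \<comment> \<open>A normal form for double brackets, so that the three arguments of
      \<open>f\<close> at depth two become comparable.\<close>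
    have jac: "brk A z (brk A x y) = brk A y (brk A x z) - brk A x (brk A y z)"
      using jacobi_A[of x y z] swap_A[of z "brk A x y"] by simp
    show ?thesis
      by (simp add: simps coeff_identities jac jacobi_A swap_A[of z y] swap_A[of z x] swap_A[of y x]
          algebra_simps)
  qed
  moreover have "- ?g (brk A x y) v + mu C v (?f x y) + rhoM C x (?g y v) - rhoM C y (?g x v)
      - ?g y (act A x v) + ?g x (act A y v) = 0" for x y v
    by (simp add: simps coeff_identities rep_A algebra_simps)
  moreover have "rhoB C (rbo A v1) (?h v2) - rhoB C (rbo A v2) (?h v1)
      - rbo B (mu C v1 (?h v2) - mu C v2 (?h v1))
      - ?h (act A (rbo A v1) v2 - act A (rbo A v2) v1)
      + ?f (rbo A v1) (rbo A v2)
      - rbo B (?g (rbo A v1) v2 - ?g (rbo A v2) v1) = 0" for v1 v2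
    by (simp add: simps coeff_identities rb_A algebra_simps)
  ultimately have "(?f, ?g, ?h) \<in> Z2 A B C"
    unfolding Z2_def by blast
  then show ?thesis
    by (simp add: coboundary_def)
qed

text \<open>The equations are oriented to push the components of the pair inward past the structure
  maps.\<close>

lemma compatible_pairsD:
  assumes "((dA, dV), (dB, dM)) \<in> compatible_pairs A B C"
  shows "Vector_Spaces.linear (lsc A) (lsc A) dA" "Vector_Spaces.linear (msc A) (msc A) dV"
    "Vector_Spaces.linear (lsc B) (lsc B) dB" "Vector_Spaces.linear (msc B) (msc B) dM"
    "dA (brk A x y) = brk A (dA x) y + brk A x (dA y)" "dA (rbo A v) = rbo A (dV v)"
    "dV (act A x v) = act A x (dV v) + act A (dA x) v"
    "dM (rhoM C x m) = rhoM C x (dM m) + rhoM C (dA x) m"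
    "dB (rhoB C x a) = rhoB C x (dB a) + rhoB C (dA x) a"
    "dM (mu C v a) = mu C (dV v) a + mu C v (dB a)"
    "dB (rbo B m) = rbo B (dM m)"
  using assms by (simp_all add: compatible_pairs_def derivations_def endomorphisms_def)

text \<open>Differentiate the cocycle equations of \<open>(om, vp, ch)\<close> along
  \<open>d\<close>: apply \<open>d\<close> to each equation and subtract the equation with
  \<open>d\<close> inserted at each argument in turn. By the Leibniz rules of a compatible pair,
  what remains is the same equation for the Wells cocycle.\<close>

lemma wells_cocycle_in_Z2:
  assumes "d \<in> compatible_pairs A B C"
  shows "wells_cocycle A E i s d \<in> Z2 A B C"
proof -
  obtain dA dV dB dM where d: "d = ((dA, dV), (dB, dM))"
    by (metis prod.exhaust)
  note D = compatible_pairsD[OF assms[unfolded d]]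
  note simps = D(1-4)[THEN linear_map_add] D(1-4)[THEN linear_map_0] D(1-4)[THEN linear_map_diff]
    D(1-4)[THEN linear_map_neg] D(1-4)[THEN linear_map_scale] ext_simps base_simps
    vector_space_simps[OF vector_spaces(3)] vector_space_simps[OF vector_spaces(4)]
  let ?f = "\<lambda>x y. dB (om x y) - om (dA x) y - om x (dA y)"
  let ?g = "\<lambda>x v. dM (vp x v) - vp (dA x) v - vp x (dV v)"
  let ?h = "\<lambda>v. dB (ch v) - ch (dV v)"
  have "bilinear_map (lsc A) (lsc A) (lsc B) ?f" "bilinear_map (lsc A) (msc A) (msc B) ?g"
    by (simp_all add: bilinear_iff vector_spaces simps algebra_simps)
  moreover have "Vector_Spaces.linear (msc A) (lsc B) ?h"
    by (simp add: Vector_Spaces.linear_iff vector_spaces simps algebra_simps)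
  moreover have "?f x x = 0" for x
    \<comment> \<open>The terms \<open>om (dA x) x\<close> and \<open>om x (dA x)\<close> cancel by
      antisymmetry.\<close>
    using alternating_swap[OF bilinear_ext(4) coeff_identities(1), of "dA x" x]
    by (simp add: coeff_identities(1) simps)
  moreover have "rhoB C x (?f y z) - rhoB C y (?f x z) + rhoB C z (?f x y)
      - ?f (brk A x y) z + ?f (brk A x z) y - ?f (brk A y z) x = 0" for x y z
  proof -
    let ?J = "\<lambda>x y z. rhoB C x (om y z) - rhoB C y (om x z) + rhoB C z (om x y)
      - om (brk A x y) z + om (brk A x z) y - om (brk A y z) x"
    have "?J x y z = 0" for x y z
      using ext_cocycle unfolding Z2_def by blast
    then have "dB (?J x y z) - ?J (dA x) y z - ?J x (dA y) z - ?J x y (dA z) = 0"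
      by (simp add: simps)
    then show ?thesis
      by (simp add: simps D(5,9) algebra_simps)
  qed
  moreover have "- ?g (brk A x y) v + mu C v (?f x y) + rhoM C x (?g y v) - rhoM C y (?g x v)
      - ?g y (act A x v) + ?g x (act A y v) = 0" for x y v
  proof -
    let ?J = "\<lambda>x y v. - vp (brk A x y) v + mu C v (om x y) + rhoM C x (vp y v)
      - rhoM C y (vp x v) - vp y (act A x v) + vp x (act A y v)"
    have "?J x y v = 0" for x y v
      using ext_cocycle unfolding Z2_def by blast
    then have "dM (?J x y v) - ?J (dA x) y v - ?J x (dA y) v - ?J x y (dV v) = 0"
      by (simp add: simps)
    then show ?thesis
      by (simp add: simps D(5,7,8,10) algebra_simps)
  qed
  moreover have "rhoB C (rbo A v1) (?h v2) - rhoB C (rbo A v2) (?h v1)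
      - rbo B (mu C v1 (?h v2) - mu C v2 (?h v1))
      - ?h (act A (rbo A v1) v2 - act A (rbo A v2) v1)
      + ?f (rbo A v1) (rbo A v2)
      - rbo B (?g (rbo A v1) v2 - ?g (rbo A v2) v1) = 0" for v1 v2
  proof -
    let ?J = "\<lambda>v1 v2. rhoB C (rbo A v1) (ch v2) - rhoB C (rbo A v2) (ch v1)
      - rbo B (mu C v1 (ch v2) - mu C v2 (ch v1))
      - ch (act A (rbo A v1) v2 - act A (rbo A v2) v1)
      + om (rbo A v1) (rbo A v2)
      - rbo B (vp (rbo A v1) v2 - vp (rbo A v2) v1)"
    have "?J v1 v2 = 0" for v1 v2
      using ext_cocycle unfolding Z2_def by blast
    \<comment> \<open>Inserting \<open>dV v1\<close> for \<open>v1\<close> also differentiates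
      \<open>rbo A v1\<close>, because the pair commutes with the Rota-Baxter operator.\<close>
    then have "dB (?J v1 v2) - ?J (dV v1) v2 - ?J v1 (dV v2) = 0"
      by (simp add: simps)
    then show ?thesis
      by (simp add: simps D(6,7,9-11) algebra_simps)
  qed
  ultimately have "(?f, ?g, ?h) \<in> Z2 A B C"
    unfolding Z2_def by blast
  then show ?thesis
    by (simp add: wells_cocycle_def d)
qed

section \<open>Derivations of the extension in block form\<close>

text \<open>In coordinates these are triangular 2 by 2 matrices: the diagonal acts on base and
  fibre, and \<open>f\<close> or \<open>g\<close> maps base to fibre.\<close>

definition "blkE dA f dB e = mkE (dA (fst p e)) (f (fst p e) + dB (qE e))"
definition "blkW dV g dM w = mkW (dV (snd p w)) (g (snd p w) + dM (qW w))"

text \<open>The diagonal is grouped like a value of \<open>wells_F\<close> and the off-diagonal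
  entries like a 1-cochain.\<close>

definition "block d f =
  (blkE (fst (fst d)) (fst f) (fst (snd d)), blkW (snd (fst d)) (snd f) (snd (snd d)))"

lemma blk_mk [simp]:
  "blkE dA f dB (mkE x a) = mkE (dA x) (f x + dB a)"
  "blkW dV g dM (mkW v m) = mkW (dV v) (g v + dM m)"
  by (simp_all add: blkE_def blkW_def)

text \<open>Joint linearity in diagonal and off-diagonal part; the linearity of both
  \<open>wells_F\<close> and \<open>wells_iota\<close> is deduced from it.\<close>

lemma block_add: "block (d + d') (f + f') = block d f + block d' f'"
  by (simp add: block_def blkE_def blkW_def plus_fun_def fun_eq_iff mk_ops add_ac)

lemma block_scale:
  "block (prod_scale (prod_scale (fun_scale (lsc A)) (fun_scale (msc A)))
      (prod_scale (fun_scale (lsc B)) (fun_scale (msc B))) c d)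
    (prod_scale (fun_scale (lsc B)) (fun_scale (msc B)) c f) =
   prod_scale (fun_scale (lsc E)) (fun_scale (msc E)) c (block d f)"
  by (simp add: block_def blkE_def blkW_def prod_scale_def fun_scale_def fun_eq_iff mk_ops
      vector_space_simps[OF vector_spaces(3)] vector_space_simps[OF vector_spaces(4)])

text \<open>Write the derivation equations in coordinates. The base components say that
  \<open>(dA, dV)\<close> is a derivation of \<open>A\<close>; the fibre components split, by
  setting variables to 0, into the compatibility conditions and the equation between coboundary and
  Wells cocycle.\<close>

lemma block_in_derivations_iff:
  assumes "Vector_Spaces.linear (lsc A) (lsc A) dA" "Vector_Spaces.linear (msc A) (msc A) dV"
    and "Vector_Spaces.linear (lsc B) (lsc B) dB" "Vector_Spaces.linear (msc B) (msc B) dM"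
    and "Vector_Spaces.linear (lsc A) (lsc B) f" "Vector_Spaces.linear (msc A) (msc B) g"
  shows "block ((dA, dV), (dB, dM)) (f, g) \<in> derivations E \<longleftrightarrow>
    ((dA, dV), (dB, dM)) \<in> compatible_pairs A B C \<and>
    coboundary A B C (f, g) = wells_cocycle A E i s ((dA, dV), (dB, dM))"
    (is "?L \<longleftrightarrow> ?R")
proof -
  note simps = assms[THEN linear_map_add] assms[THEN linear_map_0] assms[THEN linear_map_diff]
    assms[THEN linear_map_neg] assms[THEN linear_map_scale] ext_simps base_simps
  have lin: "Vector_Spaces.linear (lsc E) (lsc E) (blkE dA f dB)"
    "Vector_Spaces.linear (msc E) (msc E) (blkW dV g dM)"
    by (simp_all add: Vector_Spaces.linear_iff vector_spaces all_mk mk_ops simps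
        vector_space_simps[OF vector_spaces(3)] vector_space_simps[OF vector_spaces(4)] add_ac)
  have L: "?L \<longleftrightarrow>
    (\<forall>x a y b. dA (brk A x y) = brk A (dA x) y + brk A x (dA y) \<and>
      f (brk A x y) + dB (om x y + rhoB C x b - rhoB C y a) =
        om (dA x) y + rhoB C (dA x) b - rhoB C y (f x + dB a) +
        (om x (dA y) + rhoB C x (f y + dB b) - rhoB C (dA y) a)) \<and>
    (\<forall>v m. rbo A (dV v) = dA (rbo A v) \<and>
      ch (dV v) + rbo B (g v + dM m) = f (rbo A v) + dB (ch v + rbo B m)) \<and>
    (\<forall>x a v m. dV (act A x v) = act A x (dV v) + act A (dA x) v \<and>
      g (act A x v) + dM (vp x v + rhoM C x m - mu C v a) =
        vp x (dV v) + rhoM C x (g v + dM m) - mu C (dV v) a +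
        (vp (dA x) v + rhoM C (dA x) m - mu C v (f x + dB a)))"
    by (simp add: block_def derivations_def lin all_mk mk_ops)
  show ?thesis
  proof
    assume ?L
    then have E: "dA (brk A x y) = brk A (dA x) y + brk A x (dA y)"
      "f (brk A x y) + dB (om x y + rhoB C x b - rhoB C y a) =
        om (dA x) y + rhoB C (dA x) b - rhoB C y (f x + dB a) +
        (om x (dA y) + rhoB C x (f y + dB b) - rhoB C (dA y) a)"
      "rbo A (dV v) = dA (rbo A v)"
      "ch (dV v) + rbo B (g v + dM m) = f (rbo A v) + dB (ch v + rbo B m)"
      "dV (act A x v) = act A x (dV v) + act A (dA x) v"
      "g (act A x v) + dM (vp x v + rhoM C x m - mu C v a) =
        vp x (dV v) + rhoM C x (g v + dM m) - mu C (dV v) a +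
        (vp (dA x) v + rhoM C (dA x) m - mu C v (f x + dB a))" for x y a b v m
      unfolding L by blast+
    \<comment> \<open>With one base variable and one fibre variable left, the terms in
      \<open>f\<close>, \<open>g\<close>, \<open>om\<close>, \<open>vp\<close> and \<open>ch\<close>
      cancel or vanish, leaving one compatibility condition each time.\<close>
    have "dM (rhoM C x m) = rhoM C x (dM m) + rhoM C (dA x) m" for x m
      using E(6)[of x 0 m 0] by (simp add: simps)
    moreover have "dB (rhoB C x a) = rhoB C x (dB a) + rhoB C (dA x) a" for x a
      using E(2)[of x 0 a 0] by (simp add: simps add.commute)
    moreover have "dM (mu C v a) = mu C (dV v) a + mu C v (dB a)" for v a
      using E(6)[of 0 v 0 a] by (simp add: simps algebra_simps)
    moreover have "dB (rbo B m) = rbo B (dM m)" for m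
      using E(4)[of 0 m] by (simp add: simps)
    ultimately have "((dA, dV), (dB, dM)) \<in> compatible_pairs A B C"
      using assms E(1,3,5) by (simp add: compatible_pairs_def derivations_def endomorphisms_def)
    moreover have "coboundary A B C (f, g) = wells_cocycle A E i s ((dA, dV), (dB, dM))"
      \<comment> \<open>With all fibre variables 0, only the equation between coboundary and Wells
        cocycle is left.\<close>
      using E(2)[of _ _ 0 0] E(4)[of _ 0] E(6)[of _ _ 0 0]
      by (simp add: coboundary_def wells_cocycle_def fun_eq_iff simps algebra_simps)
    ultimately show ?R by blast
  next
    assume R: ?R
    note D = compatible_pairsD[OF conjunct1[OF R]]
    have "rhoB C x (f y) - rhoB C y (f x) - f (brk A x y) =
        dB (om x y) - om (dA x) y - om x (dA y)"
      "- mu C v (f x) + rhoM C x (g v) - g (act A x v) =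
        dM (vp x v) - vp (dA x) v - vp x (dV v)"
      "- f (rbo A v) + rbo B (g v) = dB (ch v) - ch (dV v)" for x y v
      using R by (simp_all add: coboundary_def wells_cocycle_def fun_eq_iff)
    \<comment> \<open>Solved for the images of \<open>om\<close>, \<open>vp\<close> and
      \<open>ch\<close>, the equations serve as rewrite rules.\<close>
    then have "dB (om x y) = rhoB C x (f y) - rhoB C y (f x) - f (brk A x y)
        + om (dA x) y + om x (dA y)"
      "dM (vp x v) = - mu C v (f x) + rhoM C x (g v) - g (act A x v) + vp (dA x) v + vp x (dV v)"
      "dB (ch v) = - f (rbo A v) + rbo B (g v) + ch (dV v)" for x y v
      by simp_all
    then show ?L
      unfolding L by (simp add: simps D(5-11) algebra_simps)
  qed
qed

text \<open>Only linearity is asked for; compatibility of \<open>d\<close> belongs to what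
  \<open>block d f\<close> being a derivation means.\<close>

definition "linear_data d f \<longleftrightarrow> fst d \<in> endomorphisms A \<and> snd d \<in> endomorphisms B \<and>
  Vector_Spaces.linear (lsc A) (lsc B) (fst f) \<and> Vector_Spaces.linear (msc A) (msc B) (snd f)"

lemma s_i_mk: "fst s x = mkE x 0" "snd s v = mkW v 0" "fst i a = mkE 0 a" "snd i m = mkW 0 m"
  by (simp_all add: mkE_def mkW_def base_simps)

lemma linear_q: "Vector_Spaces.linear (lsc E) (lsc B) qE" "Vector_Spaces.linear (msc E) (msc B) qW"
  by (simp_all add: Vector_Spaces.linear_iff vector_spaces all_mk mk_ops)

text \<open>A triangular map preserves \<open>B\<close> and \<open>M\<close> automatically, so only
  the derivation equations matter.\<close>

lemma block_in_ext_derivations_iff: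
  assumes "linear_data d f"
  shows "block d f \<in> ext_derivations E i \<longleftrightarrow>
    d \<in> compatible_pairs A B C \<and> coboundary A B C f = wells_cocycle A E i s d"
proof -
  obtain dA dV dB dM g h where d: "d = ((dA, dV), (dB, dM))" and f: "f = (g, h)"
    by (metis prod.exhaust)
  have lin: "Vector_Spaces.linear (lsc A) (lsc A) dA" "Vector_Spaces.linear (msc A) (msc A) dV"
    "Vector_Spaces.linear (lsc B) (lsc B) dB" "Vector_Spaces.linear (msc B) (msc B) dM"
    "Vector_Spaces.linear (lsc A) (lsc B) g" "Vector_Spaces.linear (msc A) (msc B) h"
    using assms by (simp_all add: linear_data_def endomorphisms_def d f)
  have "blkE dA g dB (fst i a) = fst i (dB a)" "blkW dV h dM (snd i m) = snd i (dM m)" for a m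
    by (simp_all add: s_i_mk lin[THEN linear_map_0])
  then have "block d f \<in> ext_derivations E i \<longleftrightarrow> block d f \<in> derivations E"
    by (auto simp: ext_derivations_def block_def d f)
  then show ?thesis
    using lin by (simp add: d f block_in_derivations_iff)
qed

text \<open>Projecting after the section reads off the base entries, and restricting to the image of
  \<open>i\<close> reads off the fibre entries.\<close>

lemma wells_F_block:
  assumes "linear_data d f"
  shows "wells_F i p s (block d f) = d"
proof -
  obtain dA dV dB dM g h where d: "d = ((dA, dV), (dB, dM))" and f: "f = (g, h)"
    by (metis prod.exhaust)
  have lin: "Vector_Spaces.linear (lsc A) (lsc A) dA" "Vector_Spaces.linear (msc A) (msc A) dV"
    "Vector_Spaces.linear (lsc B) (lsc B) dB" "Vector_Spaces.linear (msc B) (msc B) dM"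
    "Vector_Spaces.linear (lsc A) (lsc B) g" "Vector_Spaces.linear (msc A) (msc B) h"
    using assms by (simp_all add: linear_data_def endomorphisms_def d f)
  have "blkE dA g dB (fst i a) = fst i (dB a)" "blkW dV h dM (snd i m) = snd i (dM m)"
    "fst p (blkE dA g dB (fst s x)) = dA x" "snd p (blkW dV h dM (snd s v)) = dV v" for a m x v
    by (simp_all add: s_i_mk lin[THEN linear_map_0])
  then show ?thesis
    using inj_i by (simp add: wells_F_def block_def d f fun_eq_iff)
qed

text \<open>The entry from fibre to base vanishes because \<open>B\<close> and \<open>M\<close> are
  preserved; the witnesses are the other matrix entries in the coordinates of the section.\<close>

lemma ext_derivation_as_block:
  assumes "D \<in> ext_derivations E i"
  shows "\<exists>d f. linear_data d f \<and> D = block d f"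
proof -
  obtain dE dW where D: "D = (dE, dW)" by fastforce
  have lin: "Vector_Spaces.linear (lsc E) (lsc E) dE" "Vector_Spaces.linear (msc E) (msc E) dW"
    and pres: "fst p (dE (fst i a)) = 0" "snd p (dW (snd i m)) = 0" for a m
    using assms unfolding ext_derivations_def derivations_def D
    by (auto simp: in_range_i image_subset_iff)
  let ?d = "((fst p \<circ> (dE \<circ> fst s), snd p \<circ> (dW \<circ> snd s)), (qE \<circ> (dE \<circ> fst i), qW \<circ> (dW \<circ> snd i)))"
  let ?f = "(qE \<circ> (dE \<circ> fst s), qW \<circ> (dW \<circ> snd s))"
  have "linear_data ?d ?f"
    using lin linear_maps linear_q
    by (simp add: linear_data_def endomorphisms_def Vector_Spaces.linear_iff)
  moreover have "dE e = blkE (fst p \<circ> (dE \<circ> fst s)) (qE \<circ> (dE \<circ> fst s)) (qE \<circ> (dE \<circ> fst i)) e" for e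
  proof -
    obtain x a where e: "e = mkE x a"
      using mk_p_q(1) by metis
    have "dE e = dE (fst s x) + dE (fst i a)"
      by (simp add: e mkE_def linear_map_add[OF lin(1)])
    also have "\<dots> = mkE (fst p (dE (fst s x))) (qE (dE (fst s x)))
        + mkE (fst p (dE (fst i a))) (qE (dE (fst i a)))"
      by (simp only: mk_p_q)
    finally show ?thesis
      by (simp add: pres mk_ops e)
  qed
  moreover have "dW w = blkW (snd p \<circ> (dW \<circ> snd s)) (qW \<circ> (dW \<circ> snd s)) (qW \<circ> (dW \<circ> snd i)) w" for w
  proof -
    obtain v m where w: "w = mkW v m"
      using mk_p_q(2) by metis
    have "dW w = dW (snd s v) + dW (snd i m)"
      by (simp add: w mkW_def linear_map_add[OF lin(2)])
    also have "\<dots> = mkW (snd p (dW (snd s v))) (qW (dW (snd s v)))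
        + mkW (snd p (dW (snd i m))) (qW (dW (snd i m)))"
      by (simp only: mk_p_q)
    finally show ?thesis
      by (simp add: pres mk_ops w)
  qed
  ultimately show ?thesis
    unfolding D block_def by (intro exI[of _ ?d] exI[of _ ?f]) (simp add: fun_eq_iff)
qed

text \<open>Resolves the definite description: elements \<open>mkE x a\<close> and
  \<open>mkW v m\<close> exhaust the two spaces, so the prescribed values determine the
  pair.\<close>

lemma wells_iota_eq: "wells_iota i s f = block 0 f"
proof -
  let ?P = "\<lambda>d. (\<forall>x a. fst d (fst s x + fst i a) = fst i (fst f x)) \<and>
    (\<forall>v m. snd d (snd s v + snd i m) = snd i (snd f v))"
  have "?P d \<longleftrightarrow> d = block 0 f" for d
    by (simp add: prod_eq_iff fun_eq_iff all_mk block_def s_i_mk mk_ops)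
  then show ?thesis
    by (simp add: wells_iota_def)
qed

section \<open>The terms of the sequence\<close>

abbreviation "scale_Z1 \<equiv> prod_scale (fun_scale (lsc B)) (fun_scale (msc B))"
abbreviation "scale_E \<equiv> prod_scale (fun_scale (lsc E)) (fun_scale (msc E))"
abbreviation "scale_g \<equiv> prod_scale (prod_scale (fun_scale (lsc A)) (fun_scale (msc A)))
  (prod_scale (fun_scale (lsc B)) (fun_scale (msc B)))"
abbreviation "scale_Z2 \<equiv> prod_scale (fun_scale (fun_scale (lsc B)))
  (prod_scale (fun_scale (fun_scale (msc B))) (fun_scale (lsc B)))"

lemmas scales = vector_space_prod_scale vector_space_fun_scale vector_spaces

section \<open>Linearity of the coboundary and of the Wells cocycle\<close>

lemma coboundary_add: "coboundary A B C (f + f') = coboundary A B C f + coboundary A B C f'"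
  by (cases f; cases f')
    (simp add: coboundary_def plus_fun_def fun_eq_iff ext_simps base_simps algebra_simps)

lemma coboundary_scale: "coboundary A B C (scale_Z1 c f) = scale_Z2 c (coboundary A B C f)"
  by (cases f)
    (simp add: coboundary_def prod_scale_def fun_scale_def fun_eq_iff ext_simps base_simps
      vector_space_simps[OF vector_spaces(3)] vector_space_simps[OF vector_spaces(4)])

lemma wells_cocycle_add:
  "wells_cocycle A E i s (d + d') = wells_cocycle A E i s d + wells_cocycle A E i s d'"
  by (cases d; cases d')
    (auto simp: wells_cocycle_def plus_fun_def fun_eq_iff ext_simps algebra_simps)

lemma wells_cocycle_scale:
  "wells_cocycle A E i s (scale_g c d) = scale_Z2 c (wells_cocycle A E i s d)"
  by (cases d)
    (auto simp: wells_cocycle_def prod_scale_def fun_scale_def fun_eq_iff ext_simps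
      vector_space_simps[OF vector_spaces(3)] vector_space_simps[OF vector_spaces(4)])

lemma wells_cocycle_0: "wells_cocycle A E i s 0 = 0"
  using wells_cocycle_add[of 0 0] by (simp only: add_0 add_cancel_right_right)

section \<open>Cocycles, coboundaries, derivations and compatible pairs as subspaces\<close>

lemma subspace_linear_pairs:
  "module.subspace scale_Z1 ({f. Vector_Spaces.linear (lsc A) (lsc B) f} \<times>
     {g. Vector_Spaces.linear (msc A) (msc B) g})"
  by (intro subspace_Times subspace_linear_maps scales)

lemma Z1_eq: "Z1 A B C = {f \<in> {f. Vector_Spaces.linear (lsc A) (lsc B) f} \<times>
     {g. Vector_Spaces.linear (msc A) (msc B) g}. coboundary A B C f = 0}"
proof -
  have "coboundary A B C (f, g) = 0 \<longleftrightarrow>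
     (\<forall>x y. rhoB C x (f y) - rhoB C y (f x) = f (brk A x y)) \<and>
     (\<forall>x v. mu C v (f x) + g (act A x v) = rhoM C x (g v)) \<and>
     (\<forall>v. f (rbo A v) = rbo B (g v))" for f g
  proof -
    \<comment> \<open>The definition of \<open>Z1\<close> distributes the terms over the two sides
      differently from the coboundary.\<close>
    have "rhoM C x m - mu C v a = n \<longleftrightarrow> mu C v a + n = rhoM C x m"
      "rbo B m = f (rbo A v) \<longleftrightarrow> f (rbo A v) = rbo B m" for x m v a n
      by (auto simp: algebra_simps)
    then show ?thesis
      by (simp add: coboundary_def zero_prod_def fun_eq_iff)
  qed
  then show ?thesis
    unfolding Z1_def by blast
qed

lemma subspace_Z1: "module.subspace scale_Z1 (Z1 A B C)"
  unfolding Z1_eq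
  by (rule subspace_kernel[where sc' = scale_Z2])
    (intro scales subspace_linear_pairs coboundary_add coboundary_scale)+

lemma B2_eq: "B2 A B C = coboundary A B C ` ({f. Vector_Spaces.linear (lsc A) (lsc B) f} \<times>
     {g. Vector_Spaces.linear (msc A) (msc B) g})"
  by (auto simp: B2_def)

lemma subspace_B2: "module.subspace scale_Z2 (B2 A B C)"
  unfolding B2_eq
  by (rule subspace_image[where sc = scale_Z1])
    (intro scales subspace_linear_pairs coboundary_add coboundary_scale)+

text \<open>Makes the cosets in \<open>H2_space\<close> a genuine quotient of the cocycles.\<close>

lemma B2_subset_Z2: "B2 A B C \<subseteq> Z2 A B C"
  using coboundary_in_Z2 by (auto simp: B2_eq)

lemma subspace_ext_derivations: "module.subspace scale_E (ext_derivations E i)"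
proof -
  \<comment> \<open>By exactness, preservation of \<open>B\<close> and \<open>M\<close> becomes an
    equation that is linear in \<open>D\<close>.\<close>
  have eq: "ext_derivations E i = {D \<in> derivations E.
      (\<forall>a. fst p (fst D (fst i a)) = 0) \<and> (\<forall>m. snd p (snd D (snd i m)) = 0)}"
    by (auto simp: ext_derivations_def in_range_i image_subset_iff)
  show ?thesis
    unfolding eq
    by (rule subspace_restrict[OF _ subspace_derivations[OF E]])
      (simp_all add: scales prod_scale_def fun_scale_def base_simps
        vector_space_simps[OF vector_spaces(1)] vector_space_simps[OF vector_spaces(2)])
qed

lemma subspace_compatible_pairs: "module.subspace scale_g (compatible_pairs A B C)"
proof -
  have End: "module.subspace scale_Z1 (endomorphisms B)"
  proof -
    have "endomorphisms B = {f. Vector_Spaces.linear (lsc B) (lsc B) f} \<times>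
        {g. Vector_Spaces.linear (msc B) (msc B) g}"
      by (auto simp: endomorphisms_def)
    then show ?thesis
      by (simp add: subspace_Times subspace_linear_maps scales)
  qed
  let ?P = "\<lambda>d. (\<forall>x m. snd (snd d) (rhoM C x m) =
        rhoM C x (snd (snd d) m) + rhoM C (fst (fst d) x) m) \<and>
     (\<forall>x a. fst (snd d) (rhoB C x a) = rhoB C x (fst (snd d) a) + rhoB C (fst (fst d) x) a) \<and>
     (\<forall>v a. snd (snd d) (mu C v a) = mu C (snd (fst d) v) a + mu C v (fst (snd d) a)) \<and>
     (\<forall>m. fst (snd d) (rbo B m) = rbo B (snd (snd d) m))"
  have eq: "compatible_pairs A B C = {d \<in> derivations A \<times> endomorphisms B. ?P d}"
    by (auto simp: compatible_pairs_def)
  show ?thesis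
    unfolding eq
    by (rule subspace_restrict[OF _ subspace_Times[OF _ _ subspace_derivations[OF A] End]])
      (simp_all add: scales prod_scale_def fun_scale_def ext_simps base_simps algebra_simps
        vector_space_simps[OF vector_spaces(3)] vector_space_simps[OF vector_spaces(4)])
qed

text \<open>All pointwise conditions are collected into one linear map \<open>?J\<close> on triples
  of multilinear maps, and \<open>Z2\<close> is its kernel.\<close>

lemma subspace_Z2: "module.subspace scale_Z2 (Z2 A B C)"
proof -
  note simps = prod_scale_def fun_scale_def ext_simps base_simps algebra_simps
    vector_space_simps[OF vector_spaces(3)] vector_space_simps[OF vector_spaces(4)]
  let ?alt = "\<lambda>(f, g, h). \<lambda>x. f x x"
  let ?J1 = "\<lambda>(f, g, h). \<lambda>x y z. rhoB C x (f y z) - rhoB C y (f x z) + rhoB C z (f x y)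
        - f (brk A x y) z + f (brk A x z) y - f (brk A y z) x"
  let ?J2 = "\<lambda>(f, g, h). \<lambda>x y v. - g (brk A x y) v + mu C v (f x y) + rhoM C x (g y v)
        - rhoM C y (g x v) - g y (act A x v) + g x (act A y v)"
  let ?J3 = "\<lambda>(f, g, h). \<lambda>v1 v2. rhoB C (rbo A v1) (h v2) - rhoB C (rbo A v2) (h v1)
        - rbo B (mu C v1 (h v2) - mu C v2 (h v1))
        - h (act A (rbo A v1) v2 - act A (rbo A v2) v1)
        + f (rbo A v1) (rbo A v2)
        - rbo B (g (rbo A v1) v2 - g (rbo A v2) v1)"
  let ?J = "\<lambda>z. (?alt z, ?J1 z, ?J2 z, ?J3 z)"
  let ?S = "{f. bilinear_map (lsc A) (lsc A) (lsc B) f} \<times>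
    {g. bilinear_map (lsc A) (msc A) (msc B) g} \<times> {h. Vector_Spaces.linear (msc A) (lsc B) h}"
  have bil: "module.subspace (fun_scale (fun_scale sz)) {f. bilinear_map sx sy sz f}"
    if vs: "vector_space sx" "vector_space sy" "vector_space sz"
    for sx :: "'k \<Rightarrow> 'x::ab_group_add \<Rightarrow> 'x" and sy :: "'k \<Rightarrow> 'y::ab_group_add \<Rightarrow> 'y"
      and sz :: "'k \<Rightarrow> 'z::ab_group_add \<Rightarrow> 'z"
    using vector_space_simps[OF vs(3)] vs
    by (auto simp: subspace_iff vector_space_fun_scale bilinear_iff fun_scale_def mult.commute
        add_ac)
  have eq: "Z2 A B C = {z \<in> ?S. ?J z = 0}"
    unfolding Z2_def by (auto simp only: zero_prod_def zero_fun_def fun_eq_iff)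
  let ?scale = "prod_scale (fun_scale (lsc B)) (prod_scale
    (fun_scale (fun_scale (fun_scale (lsc B)))) (prod_scale
    (fun_scale (fun_scale (fun_scale (msc B)))) (fun_scale (fun_scale (lsc B)))))"
  have add: "?J (z + z') = ?J z + ?J z'" for z z'
    by (cases z; cases z') (simp add: plus_fun_def fun_eq_iff simps)
  have scale: "?J (scale_Z2 c z) = ?scale c (?J z)" for c z
    by (cases z) (simp add: fun_eq_iff simps)
  show ?thesis
    unfolding eq
    by (rule subspace_kernel[where sc' = ?scale])
      (intro scales add scale bil subspace_linear_maps subspace_Times)+
qed

section \<open>Exactness\<close>

lemma linear_data_0_iff: "linear_data 0 f \<longleftrightarrow>
    Vector_Spaces.linear (lsc A) (lsc B) (fst f) \<and> Vector_Spaces.linear (msc A) (msc B) (snd f)"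
  using vector_space_simps(4)[OF vector_spaces(1)] vector_space_simps(4)[OF vector_spaces(2)]
    vector_space_simps(4)[OF vector_spaces(3)] vector_space_simps(4)[OF vector_spaces(4)]
  by (simp add: linear_data_def endomorphisms_def zero_prod_def Vector_Spaces.linear_iff
      vector_spaces)

lemma linear_dataI:
  assumes "d \<in> compatible_pairs A B C" "f \<in> {f. Vector_Spaces.linear (lsc A) (lsc B) f} \<times>
     {g. Vector_Spaces.linear (msc A) (msc B) g}"
  shows "linear_data d f"
  using assms by (auto simp: linear_data_def compatible_pairs_def derivations_def endomorphisms_def)

lemma zero_compatible: "0 \<in> compatible_pairs A B C"
  by (rule subspace_closed(1)[OF _ subspace_compatible_pairs]) (intro scales)

text \<open>For \<open>d = 0\<close> the Wells cocycle is 0, so the condition on \<open>f\<close>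
  becomes the vanishing of its coboundary.\<close>

lemma block_0_in_iff: "linear_data 0 f \<Longrightarrow> block 0 f \<in> ext_derivations E i \<longleftrightarrow> f \<in> Z1 A B C"
  by (cases f) (simp add: block_in_ext_derivations_iff zero_compatible wells_cocycle_0 Z1_eq
      linear_data_0_iff)

lemma Z1_linear_data: "f \<in> Z1 A B C \<Longrightarrow> linear_data 0 f"
  by (auto simp: linear_data_0_iff Z1_eq)

lemma linear_data_add: "linear_data d f \<Longrightarrow> linear_data d' f' \<Longrightarrow> linear_data (d + d') (f + f')"
  using vector_space_simps(1)[OF vector_spaces(1)] vector_space_simps(1)[OF vector_spaces(2)]
    vector_space_simps(1)[OF vector_spaces(3)] vector_space_simps(1)[OF vector_spaces(4)]
  by (auto simp: linear_data_def endomorphisms_def Vector_Spaces.linear_iff add_ac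
      split: prod.splits)

lemma linear_data_scale: "linear_data d f \<Longrightarrow> linear_data (scale_g c d) (scale_Z1 c f)"
  using vector_space_simps(1,6)[OF vector_spaces(1)] vector_space_simps(1,6)[OF vector_spaces(2)]
    vector_space_simps(1,6)[OF vector_spaces(3)] vector_space_simps(1,6)[OF vector_spaces(4)]
  by (auto simp: linear_data_def endomorphisms_def Vector_Spaces.linear_iff prod_scale_def
      fun_scale_def mult.commute split: prod.splits)

section \<open>Linearity of the three maps\<close>

lemma wells_F_hom:
  "wells_F i p s \<in> vhom (ext_derivations_space E i) (compatible_pairs_space A B C)"
  unfolding ext_derivations_space_def compatible_pairs_space_def vhom_sub_vspace_iff
proof (intro conjI ballI allI)
  fix D assume D: "D \<in> ext_derivations E i"
  then obtain d f where df: "linear_data d f" "D = block d f"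
    using ext_derivation_as_block by metis
  then show "wells_F i p s D \<in> compatible_pairs A B C"
    using D by (simp add: wells_F_block block_in_ext_derivations_iff)
  \<comment> \<open>In block form \<open>wells_F\<close> is the projection to the diagonal, and the
    block form is linear.\<close>
  show "wells_F i p s (scale_E c D) = scale_g c (wells_F i p s D)" for c
    using df by (simp only: block_scale[symmetric] wells_F_block linear_data_scale)
  fix D' assume "D' \<in> ext_derivations E i"
  then obtain d' f' where "linear_data d' f'" "D' = block d' f'"
    using ext_derivation_as_block by metis
  then show "wells_F i p s (D + D') = wells_F i p s D + wells_F i p s D'"
    using df by (simp only: block_add[symmetric] wells_F_block linear_data_add)
qed

lemma wells_iota_hom:
  "wells_iota i s \<in> vhom (Z1_space A B C) (ext_derivations_space E i)"
proof -
  have "scale_g c 0 = 0" for c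
    by (rule vector_space_simps(4)) (intro scales)
  then have "block 0 (scale_Z1 c f) = scale_E c (block 0 f)" for c f
    using block_scale[of c 0 f] by metis
  moreover have "block 0 (f + f') = block 0 f + block 0 f'" for f f'
    using block_add[of 0 0 f f'] by simp
  ultimately show ?thesis
    by (simp add: Z1_space_def ext_derivations_space_def vhom_sub_vspace_iff wells_iota_eq
        block_0_in_iff Z1_linear_data)
qed

lemma wells_map_hom:
  "wells_map A B E i s \<in> vhom (compatible_pairs_space A B C) (H2_space A B C)"
proof -
  have W: "wells_map A B E i s = (\<lambda>d. coset (B2 A B C) (wells_cocycle A E i s d))"
    by (simp add: wells_map_def fun_eq_iff)
  have "wells_cocycle A E i s \<in> vhom (compatible_pairs_space A B C) (sub_vspace scale_Z2 (Z2 A B C))"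
    by (simp add: compatible_pairs_space_def vhom_sub_vspace_iff wells_cocycle_in_Z2
        wells_cocycle_add wells_cocycle_scale)
  then show ?thesis
    unfolding W H2_space_def compatible_pairs_space_def
    by (intro vhom_coset subspace_B2 scales)
qed

section \<open>Exactness at each of the first three terms\<close>

lemma kernel_wells_iota: "vkernel (Z1_space A B C) (ext_derivations_space E i) (wells_iota i s) =
    {vzero (Z1_space A B C)}"
proof -
  have "f = 0" if "block 0 f = 0" for f
  proof -
    \<comment> \<open>On the section, the fibre coordinate of \<open>block 0 f\<close> is the value
      of \<open>f\<close>.\<close>
    have "fst (block 0 f) (mkE x 0) = 0" "snd (block 0 f) (mkW v 0) = 0" for x v
      by (simp_all add: that)
    then show ?thesis
      by (simp add: block_def prod_eq_iff fun_eq_iff)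
  qed
  moreover have "block 0 0 = 0"
    using block_add[of 0 0 0 0] by (simp only: add_0 add_cancel_right_right)
  moreover have "0 \<in> Z1 A B C"
    by (rule subspace_closed(1)[OF _ subspace_Z1]) (intro scales)
  ultimately show ?thesis
    by (auto simp: vkernel_def Z1_space_def ext_derivations_space_def sub_vspace_def wells_iota_eq)
qed

text \<open>A derivation killed by \<open>wells_F\<close> has zero diagonal, so only its
  off-diagonal part is left, and this is a 1-cocycle.\<close>

lemma image_wells_iota: "wells_iota i s ` vcarrier (Z1_space A B C) =
    vkernel (ext_derivations_space E i) (compatible_pairs_space A B C) (wells_F i p s)"
proof -
  have "D \<in> block 0 ` Z1 A B C" if D: "D \<in> ext_derivations E i" "wells_F i p s D = 0" for D
  proof -
    obtain d f where df: "linear_data d f" "D = block d f"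
      using ext_derivation_as_block[OF D(1)] by metis
    then have "d = 0"
      using D(2) by (simp add: wells_F_block)
    then show ?thesis
      using df D(1) block_0_in_iff by blast
  qed
  then show ?thesis
    by (auto simp: vkernel_def Z1_space_def ext_derivations_space_def compatible_pairs_space_def
        sub_vspace_def wells_iota_eq block_0_in_iff Z1_linear_data wells_F_block)
qed

text \<open>A compatible pair lifts exactly when its Wells cocycle is the coboundary of some
  \<open>f\<close>: the \<open>f\<close> in question are the off-diagonal parts of its
  lifts.\<close>

lemma image_wells_F: "wells_F i p s ` vcarrier (ext_derivations_space E i) =
    vkernel (compatible_pairs_space A B C) (H2_space A B C) (wells_map A B E i s)"
proof -
  have "wells_F i p s ` ext_derivations E i =
    {d \<in> compatible_pairs A B C. wells_cocycle A E i s d \<in> B2 A B C}"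
  proof (intro equalityI subsetI)
    fix d assume "d \<in> wells_F i p s ` ext_derivations E i"
    then obtain D where D: "D \<in> ext_derivations E i" "d = wells_F i p s D"
      by blast
    obtain d' f where f': "linear_data d' f" "D = block d' f"
      using ext_derivation_as_block[OF D(1)] by blast
    then have f: "linear_data d f" "D = block d f"
      using D(2) wells_F_block[OF f'(1)] by simp_all
    then have "d \<in> compatible_pairs A B C" "wells_cocycle A E i s d = coboundary A B C f"
      using D(1) by (simp_all add: block_in_ext_derivations_iff)
    moreover have "f \<in> {f. Vector_Spaces.linear (lsc A) (lsc B) f} \<times>
        {g. Vector_Spaces.linear (msc A) (msc B) g}"
      using f(1) by (simp add: linear_data_def mem_Times_iff)
    ultimately show "d \<in> {d \<in> compatible_pairs A B C. wells_cocycle A E i s d \<in> B2 A B C}"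
      unfolding B2_eq by blast
  next
    fix d assume d: "d \<in> {d \<in> compatible_pairs A B C. wells_cocycle A E i s d \<in> B2 A B C}"
    then obtain f where f: "wells_cocycle A E i s d = coboundary A B C f"
      "f \<in> {f. Vector_Spaces.linear (lsc A) (lsc B) f} \<times>
        {g. Vector_Spaces.linear (msc A) (msc B) g}"
      unfolding B2_eq by blast
    then have df: "linear_data d f"
      using d linear_dataI by blast
    then have "block d f \<in> ext_derivations E i"
      using d f(1) by (simp add: block_in_ext_derivations_iff)
    from imageI[OF this, of "wells_F i p s"]
    show "d \<in> wells_F i p s ` ext_derivations E i"
      by (simp add: wells_F_block[OF df])
  qed
  moreover have "coset (B2 A B C) z = B2 A B C \<longleftrightarrow> z \<in> B2 A B C" for z
    by (rule coset_eq_self_iff[OF _ subspace_B2]) (intro scales)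
  ultimately show ?thesis
    unfolding vkernel_def ext_derivations_space_def compatible_pairs_space_def H2_space_def
        sub_vspace_def quotient_vspace_def wells_map_def vspace.simps by blast
qed

lemma exact_sequence:
  "exact_0_4 (Z1_space A B C) (wells_iota i s) (ext_derivations_space E i) (wells_F i p s)
    (compatible_pairs_space A B C) (wells_map A B E i s) (H2_space A B C)"
proof -
  have "is_vspace (Z1_space A B C)" "is_vspace (ext_derivations_space E i)"
    "is_vspace (compatible_pairs_space A B C)" "is_vspace (H2_space A B C)"
    unfolding Z1_space_def ext_derivations_space_def compatible_pairs_space_def H2_space_def
    by (intro is_vspace_sub_vspace is_vspace_quotient_vspace scales subspace_Z1
        subspace_ext_derivations subspace_compatible_pairs subspace_Z2 subspace_B2)+
  then show ?thesis
    unfolding exact_0_4_def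
    using wells_iota_hom wells_F_hom wells_map_hom kernel_wells_iota image_wells_iota
      image_wells_F by blast
qed

end

theorem theorem6p5:
  fixes A :: "('k::field, 'a::ab_group_add, 'v::ab_group_add) rrb_data"
    and B :: "('k, 'b::ab_group_add, 'm::ab_group_add) rrb_data"
    and E :: "('k, 'e::ab_group_add, 'w::ab_group_add) rrb_data"
    and i :: "('b \<Rightarrow> 'e) \<times> ('m \<Rightarrow> 'w)"
    and p :: "('e \<Rightarrow> 'a) \<times> ('w \<Rightarrow> 'v)"
    and s :: "('a \<Rightarrow> 'e) \<times> ('v \<Rightarrow> 'w)"
  assumes "rel_rota_baxter A"
    and "rel_rota_baxter B"
    and "abelian_extension A B E i p"
    and "extension_section A E p s"
  shows "B2 A B (ext_coeffs E i s) \<subseteq> Z2 A B (ext_coeffs E i s) \<and>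
    exact_0_4
      (Z1_space A B (ext_coeffs E i s)) (wells_iota i s)
      (ext_derivations_space E i) (wells_F i p s)
      (compatible_pairs_space A B (ext_coeffs E i s)) (wells_map A B E i s)
      (H2_space A B (ext_coeffs E i s))"
proof -
  interpret rrb_split_extension A B E i p s
    using assms by unfold_locales
  show ?thesis
    using B2_subset_Z2 exact_sequence by blast
qed

end
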